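(* The categories $\mathbf{CSL}$ and $\mathbf{SIF}_{\mathbf{t}}$ are isomorphic.
   Context: For a set $A$, $X \subseteq_\mathrm{fin} A$ means $X$ is a finite subset of $A$, and $\mathcal{P}_f(A)$ is the set of finite subsets of $A$. A continuous information frame is a triple $\mathbb{A} = (A, (\mathrm{Con}_i)_{i \in A}, (\vDash_i)_{i \in A})$ with $\mathrm{Con}_i \subseteq \mathcal{P}_f(A)$ and $\vDash_i \subseteq \mathrm{Con}_i \times A$; write $iRj$ iff $\{i\} \in \mathrm{Con}_j$, and $X \vDash_i Y$ iff $X \vDash_i b$ for all $b \in Y$. Required, for all $i,j,a \in A$ and finite $X,Y \subseteq A$: $\{i\} \in \mathrm{Con}_i$; $Y \subseteq X \in \mathrm{Con}_i \Rightarrow Y \in \mathrm{Con}_i$; $X \in \mathrm{Con}_i$ and $X \vDash_i Y \Rightarrow Y \in \mathrm{Con}_i$; $X,Y \in \mathrm{Con}_i$, $X \subseteq Y$, $X \vDash_i a \Rightarrow Y \vDash_i a$; $X \in \mathrm{Con}_i$, $X \vDash_i Y$, $Y \vDash_i a \Rightarrow X \vDash_i a$; $iRj \Rightarrow \mathrm{Con}_i \subseteq \mathrm{Con}_j$; $iRj$, $X \in \mathrm{Con}_i$, $X \vDash_i a \Rightarrow X \vDash_j a$; and $X \vDash_i Y \Rightarrow$ there are $e \in A$, $Z \in \mathrm{Con}_e$ with $X \vDash_i \{e\} \cup Z$ and $Z \vDash_e Y$. It is strong if $X \in \mathrm{Con}_i$ and $X \neq \{i\}$ imply $\{i\} \vDash_i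 X$. A token $\mathbf{t}$ is a truth element if $\emptyset \vDash_i \mathbf{t}$ for all $i \in A$. An approximable family $\mathbb{H}=(H_i)_{i\in A}$ from $\mathbb{A}$ to $\mathbb{A}'$ consists of $H_i \subseteq \mathrm{Con}_i \times A'$ (with $XH_iY$ meaning $XH_ic$ for all $c\in Y$) such that for $X,X' \in \mathrm{Con}_i$, $b,k \in A'$, finite $F \subseteq A'$: (1) $X H_i (\{k\}\cup Y)$ and $Y \vDash'_k b \Rightarrow X H_i b$; (2) $X \subseteq X'$ and $X H_i b \Rightarrow X' H_i b$; (3) $X \vDash_i X'$ and $X' H_i b \Rightarrow X H_i b$; (4) $iRj$ and $X H_i b \Rightarrow X H_j b$; (5) $X H_i F \Rightarrow$ there are $c \in A$, $e \in A'$, $U \in \mathrm{Con}_c$, $V \in \mathrm{Con}'_e$ with $X \vDash_i \{c\}\cup U$, $U H_c (\{e\}\cup V)$, $V \vDash'_e F$. It respects truth elements $\mathbf{t},\mathbf{t}'$ if $\emptyset H_{\mathbf{t}} \mathbf{t}'$. Composition: $X(\mathbb{G}\circ\mathbb{H})_i a$ iff there are $e$ and $V \in \mathrm{Con}^{(2)}_e$ with $X G_i (\{e\}\cup V)$ and $V H_e a$; identities are $(\vDash_i)_{i\in A}$. $\mathbf{SIF}_{\mathbf{t}}$ is the category of strong continuous information frames with truth elements and truth-element-respecting approximable families. For a set $P$ of atomic propositions containing a constant $\top$, $\mathcal{L}(P)$ is the set of formulas built from atoms by $\land$; $\bigwedge\Gamma$ is the left-bracketed conjunction of a finite set $\Gamma$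 ($\bigwedge\emptyset = \top$), and $\overline{\varphi}$ is the set of atoms occurring in $\varphi$. A continuous stratified conjunctive logic is $\mathbb{P}=(P,(P_p)_{p\in P},(\vdash^p)_{p\in P})$ with $P_p \subseteq P$, $\vdash^p \subseteq (\mathcal{P}_f(\mathcal{L}(P_p)) \cup \{\{p\}\}) \times \mathcal{L}(P_p)$, such that: $q \in P_p \Rightarrow p \vdash^p q$; $q \vdash^q p \Rightarrow P_p \subseteq P_q$; $q \vdash^q p$ and $\Gamma \vdash^p \theta \Rightarrow \Gamma \vdash^q \theta$; each $\vdash^p$ is closed under (R$\top$) $\Gamma \vdash^p \top$, (L$\land$) $\Delta,\varphi,\psi \vdash^p \theta \iff \Delta,\varphi\land\psi \vdash^p\theta$, (R$\land$) $\Gamma\vdash^p\varphi$ and $\Gamma\vdash^p\psi \iff \Gamma\vdash^p\varphi\land\psi$, (Cut) from $\Gamma\vdash^p\varphi$ and $\varphi\vdash^p\psi$ infer $\Gamma\vdash^p\psi$, (W) from $\Delta\vdash^p\varphi$ and $\xi\in\mathcal{L}(P_p)$ infer $\Delta,\xi\vdash^p\varphi$; and (INT) $\Gamma\vdash^p\varphi \Rightarrow$ there are $r\in P_p$, $\xi\in\mathcal{L}(P_r)$ with $\Gamma\vdash^p r\land\xi$ and $\xi\vdash^r\varphi$. A global consequence relation $\mathrel|\!\sim$ from $\mathbb{P}$ to $\mathbb{P}'$ is a family of relations $\mathrel|\!\sim^p \subseteq (\mathcal{P}_f(\mathcal{L}(P_p))\cup\{\{p\}\})\times\mathcal{L}(P')$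 closed under (R$\top$), (W), (L$\land$), (R$\land$), (Lcut) from $\Gamma\vdash^p\varphi$ and $\varphi\mathrel|\!\sim^p\psi$ infer $\Gamma\mathrel|\!\sim^p\psi$, (Rcut) from $\Gamma\mathrel|\!\sim^p q\land\psi$ and $\psi\vdash'^q\theta$ infer $\Gamma\mathrel|\!\sim^p\theta$; such that $p\vdash^p r$ and $\Gamma\mathrel|\!\sim^r\psi$ imply $\Gamma\mathrel|\!\sim^p\psi$; and $\Gamma\mathrel|\!\sim^p\varphi$ implies there are $r\in P$, $\theta\in\mathcal{L}(P_r)\cup\{r\}$, $q\in P'$, $\psi\in\mathcal{L}(P'_q)\cup\{q\}$ with $\Gamma\vdash^p r\land\theta$, $\theta\mathrel|\!\sim^r q\land\psi$, $\psi\vdash'^q\varphi$. Composition: $\Gamma(\mathrel|\!\sim_1\circ\mathrel|\!\sim_2)^p\varphi$ iff there are $q\in P'$, $\psi\in\mathcal{L}(P'_q)\cup\{q\}$ with $\Gamma\mathrel|\!\sim_1^p q\land\psi$ and $\psi\mathrel|\!\sim_2^q\varphi$; identities are $(\vdash^p)_{p\in P}$. $\mathbf{CSL}$ is the category of continuous stratified conjunctive logics and global consequence relations. *)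

theory Defs
  imports "HOL-Library.FuncSet"
begin

section \<open>Categories\<close>

text \<open>Composition is written in diagrammatic order: for \<open>f \<in> Hom C X Y\<close> and \<open>g \<in> Hom C Y Z\<close>,
  \<open>Comp C X Y Z f g\<close> is \<open>f\<close> followed by \<open>g\<close>. Hom-sets of different pairs of objects need not be
  disjoint, so arrow operations take the objects involved as arguments.\<close>

record ('o, 'm) cat =
  Obj :: "'o set"
  Hom :: "'o \<Rightarrow> 'o \<Rightarrow> 'm set"
  Id :: "'o \<Rightarrow> 'm"
  Comp :: "'o \<Rightarrow> 'o \<Rightarrow> 'o \<Rightarrow> 'm \<Rightarrow> 'm \<Rightarrow> 'm"

locale category =
  fixes C :: "('o, 'm) cat"
  assumes Id_in_Hom: "X \<in> Obj C \<Longrightarrow> Id C X \<in> Hom C X X"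
    and Comp_in_Hom: "\<lbrakk>X \<in> Obj C; Y \<in> Obj C; Z \<in> Obj C; f \<in> Hom C X Y; g \<in> Hom C Y Z\<rbrakk>
      \<Longrightarrow> Comp C X Y Z f g \<in> Hom C X Z"
    and Comp_Id_left: "\<lbrakk>X \<in> Obj C; Y \<in> Obj C; f \<in> Hom C X Y\<rbrakk>
      \<Longrightarrow> Comp C X X Y (Id C X) f = f"
    and Comp_Id_right: "\<lbrakk>X \<in> Obj C; Y \<in> Obj C; f \<in> Hom C X Y\<rbrakk>
      \<Longrightarrow> Comp C X Y Y f (Id C Y) = f"
    and Comp_assoc: "\<lbrakk>W \<in> Obj C; X \<in> Obj C; Y \<in> Obj C; Z \<in> Obj C;
        f \<in> Hom C W X; g \<in> Hom C X Y; h \<in> Hom C Y Z\<rbrakk>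
      \<Longrightarrow> Comp C W Y Z (Comp C W X Y f g) h = Comp C W X Z f (Comp C X Y Z g h)"

locale cat_functor = C: category C + D: category D
  for C :: "('o, 'm) cat" and D :: "('p, 'n) cat" +
  fixes Fo :: "'o \<Rightarrow> 'p" and Fm :: "'o \<Rightarrow> 'o \<Rightarrow> 'm \<Rightarrow> 'n"
  assumes Obj_map: "X \<in> Obj C \<Longrightarrow> Fo X \<in> Obj D"
    and Hom_map: "\<lbrakk>X \<in> Obj C; Y \<in> Obj C; f \<in> Hom C X Y\<rbrakk>
      \<Longrightarrow> Fm X Y f \<in> Hom D (Fo X) (Fo Y)"
    and Id_map: "X \<in> Obj C \<Longrightarrow> Fm X X (Id C X) = Id D (Fo X)"
    and Comp_map: "\<lbrakk>X \<in> Obj C; Y \<in> Obj C; Z \<in> Obj C; f \<in> Hom C X Y; g \<in> Hom C Y Z\<rbrakk>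
      \<Longrightarrow> Fm X Z (Comp C X Y Z f g) = Comp D (Fo X) (Fo Y) (Fo Z) (Fm X Y f) (Fm Y Z g)"

definition isomorphic_categories :: "('o, 'm) cat \<Rightarrow> ('p, 'n) cat \<Rightarrow> bool" where
  "isomorphic_categories C D \<longleftrightarrow> (\<exists>Fo Fm Go Gm.
     cat_functor C D Fo Fm \<and> cat_functor D C Go Gm \<and>
     (\<forall>X \<in> Obj C. Go (Fo X) = X) \<and>
     (\<forall>X \<in> Obj C. \<forall>Y \<in> Obj C. \<forall>f \<in> Hom C X Y. Gm (Fo X) (Fo Y) (Fm X Y f) = f) \<and>
     (\<forall>X \<in> Obj D. Fo (Go X) = X) \<and>
     (\<forall>X \<in> Obj D. \<forall>Y \<in> Obj D. \<forall>g \<in> Hom D X Y. Fm (Go X) (Go Y) (Gm X Y g) = g))"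


section \<open>Continuous information frames\<close>

text \<open>Families indexed by a set \<open>A\<close> are extensional functions on \<open>A\<close> (elements of a \<open>PiE\<close>), so that
  equality of HOL functions is equality of families; likewise for logics below.\<close>

record 'a frame =
  Tok :: "'a set"
  Con :: "'a \<Rightarrow> 'a set set"
  Ent :: "'a \<Rightarrow> ('a set \<times> 'a) set"

abbreviation entails :: "('a, 'z) frame_scheme \<Rightarrow> 'a \<Rightarrow> 'a set \<Rightarrow> 'a \<Rightarrow> bool" where
  "entails A i X a \<equiv> (X, a) \<in> Ent A i"

abbreviation entails_set :: "('a, 'z) frame_scheme \<Rightarrow> 'a \<Rightarrow> 'a set \<Rightarrow> 'a set \<Rightarrow> bool" where
  "entails_set A i X Y \<equiv> \<forall>b \<in> Y. entails A i X b"

abbreviation frame_R :: "('a, 'z) frame_scheme \<Rightarrow> 'a \<Rightarrow> 'a \<Rightarrow> bool" where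
  "frame_R A i j \<equiv> {i} \<in> Con A j"

text \<open>\<open>entails_set A i X {}\<close> holds vacuously for every \<open>X\<close>; therefore \<open>X \<in> Con A i\<close> is always
  required explicitly.\<close>

locale cont_info_frame =
  fixes A :: "('a, 'z) frame_scheme"
  assumes Con_family: "Con A \<in> Tok A \<rightarrow>\<^sub>E Pow (Fpow (Tok A))"
    and Ent_family: "Ent A \<in> (\<Pi>\<^sub>E i \<in> Tok A. Pow (Con A i \<times> Tok A))"
    and Con_self: "i \<in> Tok A \<Longrightarrow> {i} \<in> Con A i"
    and Con_down: "\<lbrakk>i \<in> Tok A; Y \<subseteq> X; X \<in> Con A i\<rbrakk> \<Longrightarrow> Y \<in> Con A i"
    and Con_Ent: "\<lbrakk>i \<in> Tok A; Y \<in> Fpow (Tok A); X \<in> Con A i; entails_set A i X Y\<rbrakk>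
      \<Longrightarrow> Y \<in> Con A i"
    and Ent_mono: "\<lbrakk>i \<in> Tok A; X \<in> Con A i; Y \<in> Con A i; X \<subseteq> Y; entails A i X a\<rbrakk>
      \<Longrightarrow> entails A i Y a"
    and Ent_trans: "\<lbrakk>i \<in> Tok A; Y \<in> Fpow (Tok A); X \<in> Con A i; entails_set A i X Y;
        entails A i Y a\<rbrakk> \<Longrightarrow> entails A i X a"
    and R_Con: "\<lbrakk>i \<in> Tok A; j \<in> Tok A; frame_R A i j\<rbrakk> \<Longrightarrow> Con A i \<subseteq> Con A j"
    and R_Ent: "\<lbrakk>i \<in> Tok A; j \<in> Tok A; frame_R A i j; X \<in> Con A i; entails A i X a\<rbrakk>
      \<Longrightarrow> entails A j X a"
    and interpolation: "\<lbrakk>i \<in> Tok A; Y \<in> Fpow (Tok A); X \<in> Con A i; entails_set A i X Y\<rbrakk>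
      \<Longrightarrow> \<exists>e \<in> Tok A. \<exists>Z \<in> Con A e. entails_set A i X ({e} \<union> Z) \<and> entails_set A e Z Y"

locale strong_cont_info_frame = cont_info_frame +
  assumes strong: "\<lbrakk>i \<in> Tok A; X \<in> Con A i; X \<noteq> {i}\<rbrakk> \<Longrightarrow> entails_set A i {i} X"

definition truth_element :: "('a, 'z) frame_scheme \<Rightarrow> 'a \<Rightarrow> bool" where
  "truth_element A t \<longleftrightarrow> t \<in> Tok A \<and> (\<forall>i \<in> Tok A. entails A i {} t)"

type_synonym ('a, 'b) rel_family = "'a \<Rightarrow> ('a set \<times> 'b) set"

abbreviation rel_set :: "('a, 'b) rel_family \<Rightarrow> 'a \<Rightarrow> 'a set \<Rightarrow> 'b set \<Rightarrow> bool" where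
  "rel_set H i X Y \<equiv> \<forall>c \<in> Y. (X, c) \<in> H i"

locale approximable_family =
  fixes A :: "('a, 'z) frame_scheme" and A' :: "('b, 'y) frame_scheme"
    and H :: "('a, 'b) rel_family"
  assumes family: "H \<in> (\<Pi>\<^sub>E i \<in> Tok A. Pow (Con A i \<times> Tok A'))"
    and Ent_right: "\<lbrakk>i \<in> Tok A; X \<in> Con A i; k \<in> Tok A'; b \<in> Tok A'; Y \<in> Fpow (Tok A');
        rel_set H i X ({k} \<union> Y); entails A' k Y b\<rbrakk> \<Longrightarrow> (X, b) \<in> H i"
    and mono: "\<lbrakk>i \<in> Tok A; X \<in> Con A i; X' \<in> Con A i; b \<in> Tok A'; X \<subseteq> X'; (X, b) \<in> H i\<rbrakk>
      \<Longrightarrow> (X', b) \<in> H i"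
    and Ent_left: "\<lbrakk>i \<in> Tok A; X \<in> Con A i; X' \<in> Con A i; b \<in> Tok A'; entails_set A i X X';
        (X', b) \<in> H i\<rbrakk> \<Longrightarrow> (X, b) \<in> H i"
    and R_mono: "\<lbrakk>i \<in> Tok A; j \<in> Tok A; frame_R A i j; X \<in> Con A i; b \<in> Tok A'; (X, b) \<in> H i\<rbrakk>
      \<Longrightarrow> (X, b) \<in> H j"
    and interpolation: "\<lbrakk>i \<in> Tok A; X \<in> Con A i; F \<in> Fpow (Tok A'); rel_set H i X F\<rbrakk>
      \<Longrightarrow> \<exists>c \<in> Tok A. \<exists>e \<in> Tok A'. \<exists>U \<in> Con A c. \<exists>V \<in> Con A' e.
            entails_set A i X ({c} \<union> U) \<and> rel_set H c U ({e} \<union> V) \<and> entails_set A' e V F"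

definition comp_families ::
  "('a, 'x) frame_scheme \<Rightarrow> ('b, 'y) frame_scheme \<Rightarrow> ('c, 'z) frame_scheme \<Rightarrow>
   ('a, 'b) rel_family \<Rightarrow> ('b, 'c) rel_family \<Rightarrow> ('a, 'c) rel_family" where
  "comp_families A A' A'' G H = (\<lambda>i \<in> Tok A. {(X, a). X \<in> Con A i \<and> a \<in> Tok A'' \<and>
     (\<exists>e \<in> Tok A'. \<exists>V \<in> Con A' e. rel_set G i X ({e} \<union> V) \<and> (V, a) \<in> H e)})"

record 'a truth_frame = "'a frame" +
  Truth :: 'a

definition SIFt :: "('a truth_frame, ('a, 'a) rel_family) cat" where
  "SIFt = \<lparr>
     Obj = {A. strong_cont_info_frame A \<and> truth_element A (Truth A)},
     Hom = (\<lambda>A A'. {H. approximable_family A A' H \<and> ({}, Truth A') \<in> H (Truth A)}),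
     Id = Ent,
     Comp = comp_families \<rparr>"


section \<open>Continuous stratified conjunctive logics\<close>

datatype (atoms: 'a) form = Atom 'a | And "'a form" "'a form"

definition Lang :: "'a set \<Rightarrow> 'a form set" where
  "Lang Q = {\<phi>. atoms \<phi> \<subseteq> Q}"

text \<open>The constant \<open>\<top>\<close> belongs to the data of a logic, in the same way as the truth element
  belongs to the data of an object of \<open>SIFt\<close>.\<close>

record 'a csl =
  Prp :: "'a set"
  Top :: 'a
  Str :: "'a \<Rightarrow> 'a set"
  Prv :: "'a \<Rightarrow> ('a form set \<times> 'a form) set"

abbreviation LangAt :: "'a csl \<Rightarrow> 'a \<Rightarrow> 'a form set" where
  "LangAt P p \<equiv> Lang (Str P p)"

definition Antecedents :: "'a csl \<Rightarrow> 'a \<Rightarrow> 'a form set set" where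
  "Antecedents P p = Fpow (LangAt P p) \<union> {{Atom p}}"

abbreviation proves :: "'a csl \<Rightarrow> 'a \<Rightarrow> 'a form set \<Rightarrow> 'a form \<Rightarrow> bool" where
  "proves P p \<Gamma> \<phi> \<equiv> (\<Gamma>, \<phi>) \<in> Prv P p"

text \<open>In the rules, \<open>\<Gamma>\<close> ranges over all admissible antecedents, including \<open>{p}\<close>, whereas the
  context \<open>\<Delta>\<close> in (L\<open>\<and>\<close>) and (W) is a finite set of formulas over \<open>P\<^sub>p\<close>. Since \<open>p \<in> P\<^sub>p\<close> is not
  required, an antecedent \<open>p, \<xi>\<close> need not be admissible.\<close>

locale cont_strat_conj_logic =
  fixes P :: "'a csl"
  assumes Top_in: "Top P \<in> Prp P"
    and Str_family: "Str P \<in> Prp P \<rightarrow>\<^sub>E Pow (Prp P)"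
    and Prv_family: "Prv P \<in> (\<Pi>\<^sub>E p \<in> Prp P. Pow (Antecedents P p \<times> LangAt P p))"
    and Str_Prv: "\<lbrakk>p \<in> Prp P; q \<in> Str P p\<rbrakk> \<Longrightarrow> proves P p {Atom p} (Atom q)"
    and Str_mono: "\<lbrakk>p \<in> Prp P; q \<in> Prp P; proves P q {Atom q} (Atom p)\<rbrakk>
      \<Longrightarrow> Str P p \<subseteq> Str P q"
    and Prv_mono: "\<lbrakk>p \<in> Prp P; q \<in> Prp P; proves P q {Atom q} (Atom p); proves P p \<Gamma> \<theta>\<rbrakk>
      \<Longrightarrow> proves P q \<Gamma> \<theta>"
    and R_Top: "\<lbrakk>p \<in> Prp P; \<Gamma> \<in> Antecedents P p\<rbrakk> \<Longrightarrow> proves P p \<Gamma> (Atom (Top P))"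
    and L_And: "\<lbrakk>p \<in> Prp P; \<Delta> \<in> Fpow (LangAt P p); \<phi> \<in> LangAt P p; \<psi> \<in> LangAt P p\<rbrakk>
      \<Longrightarrow> proves P p (\<Delta> \<union> {\<phi>, \<psi>}) \<theta> \<longleftrightarrow> proves P p (\<Delta> \<union> {And \<phi> \<psi>}) \<theta>"
    and R_And: "\<lbrakk>p \<in> Prp P; \<Gamma> \<in> Antecedents P p\<rbrakk>
      \<Longrightarrow> proves P p \<Gamma> \<phi> \<and> proves P p \<Gamma> \<psi> \<longleftrightarrow> proves P p \<Gamma> (And \<phi> \<psi>)"
    and Cut: "\<lbrakk>p \<in> Prp P; proves P p \<Gamma> \<phi>; proves P p {\<phi>} \<psi>\<rbrakk> \<Longrightarrow> proves P p \<Gamma> \<psi>"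
    and W: "\<lbrakk>p \<in> Prp P; \<Delta> \<in> Fpow (LangAt P p); \<xi> \<in> LangAt P p; proves P p \<Delta> \<phi>\<rbrakk>
      \<Longrightarrow> proves P p (\<Delta> \<union> {\<xi>}) \<phi>"
    and INT: "\<lbrakk>p \<in> Prp P; proves P p \<Gamma> \<phi>\<rbrakk>
      \<Longrightarrow> \<exists>r \<in> Str P p. \<exists>\<xi> \<in> LangAt P r.
            proves P p \<Gamma> (And (Atom r) \<xi>) \<and> proves P r {\<xi>} \<phi>"

type_synonym 'a csl_rel = "'a \<Rightarrow> ('a form set \<times> 'a form) set"

locale global_consequence =
  fixes P P' :: "'a csl" and S :: "'a csl_rel"
  assumes family: "S \<in> (\<Pi>\<^sub>E p \<in> Prp P. Pow (Antecedents P p \<times> Lang (Prp P')))"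
    and R_Top: "\<lbrakk>p \<in> Prp P; \<Gamma> \<in> Antecedents P p\<rbrakk> \<Longrightarrow> (\<Gamma>, Atom (Top P')) \<in> S p"
    and W: "\<lbrakk>p \<in> Prp P; \<Delta> \<in> Fpow (LangAt P p); \<xi> \<in> LangAt P p; (\<Delta>, \<phi>) \<in> S p\<rbrakk>
      \<Longrightarrow> (\<Delta> \<union> {\<xi>}, \<phi>) \<in> S p"
    and L_And: "\<lbrakk>p \<in> Prp P; \<Delta> \<in> Fpow (LangAt P p); \<phi> \<in> LangAt P p; \<psi> \<in> LangAt P p\<rbrakk>
      \<Longrightarrow> (\<Delta> \<union> {\<phi>, \<psi>}, \<theta>) \<in> S p \<longleftrightarrow> (\<Delta> \<union> {And \<phi> \<psi>}, \<theta>) \<in> S p"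
    and R_And: "\<lbrakk>p \<in> Prp P; \<Gamma> \<in> Antecedents P p\<rbrakk>
      \<Longrightarrow> (\<Gamma>, \<phi>) \<in> S p \<and> (\<Gamma>, \<psi>) \<in> S p \<longleftrightarrow> (\<Gamma>, And \<phi> \<psi>) \<in> S p"
    and Lcut: "\<lbrakk>p \<in> Prp P; proves P p \<Gamma> \<phi>; ({\<phi>}, \<psi>) \<in> S p\<rbrakk> \<Longrightarrow> (\<Gamma>, \<psi>) \<in> S p"
    and Rcut: "\<lbrakk>p \<in> Prp P; q \<in> Prp P'; (\<Gamma>, And (Atom q) \<psi>) \<in> S p; proves P' q {\<psi>} \<theta>\<rbrakk>
      \<Longrightarrow> (\<Gamma>, \<theta>) \<in> S p"
    and mono: "\<lbrakk>p \<in> Prp P; r \<in> Prp P; proves P p {Atom p} (Atom r); (\<Gamma>, \<psi>) \<in> S r\<rbrakk>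
      \<Longrightarrow> (\<Gamma>, \<psi>) \<in> S p"
    and interpolation: "\<lbrakk>p \<in> Prp P; (\<Gamma>, \<phi>) \<in> S p\<rbrakk>
      \<Longrightarrow> \<exists>r \<in> Prp P. \<exists>\<theta> \<in> LangAt P r \<union> {Atom r}. \<exists>q \<in> Prp P'. \<exists>\<psi> \<in> LangAt P' q \<union> {Atom q}.
            proves P p \<Gamma> (And (Atom r) \<theta>) \<and> ({\<theta>}, And (Atom q) \<psi>) \<in> S r \<and>
            proves P' q {\<psi>} \<phi>"

definition comp_consequence ::
  "'a csl \<Rightarrow> 'a csl \<Rightarrow> 'a csl \<Rightarrow> 'a csl_rel \<Rightarrow> 'a csl_rel \<Rightarrow> 'a csl_rel" where
  "comp_consequence P P' P'' S T = (\<lambda>p \<in> Prp P. {(\<Gamma>, \<phi>).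
     \<Gamma> \<in> Antecedents P p \<and> \<phi> \<in> Lang (Prp P'') \<and>
     (\<exists>q \<in> Prp P'. \<exists>\<psi> \<in> LangAt P' q \<union> {Atom q}.
        (\<Gamma>, And (Atom q) \<psi>) \<in> S p \<and> ({\<psi>}, \<phi>) \<in> T q)})"

definition CSL :: "('a csl, 'a csl_rel) cat" where
  "CSL = \<lparr>
     Obj = {P. cont_strat_conj_logic P},
     Hom = (\<lambda>P P'. {S. global_consequence P P' S}),
     Id = Prv,
     Comp = comp_consequence \<rparr>"

end

theory Submission
  imports Defs
begin

text \<open>By (L\<open>\<and>\<close>) and (R\<open>\<and>\<close>), a provability or global consequence relation is determined by its
  instances \<open>Atom ` X \<turnstile> Atom a\<close>. Restricting to these instances turns a logic into a strong frame
  whose consistent sets at \<open>p\<close> are \<open>{p}\<close> and the finite subsets of \<open>P\<^sub>p\<close>. Conversely, in a strong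
  frame \<open>Con\<^sub>i\<close> necessarily consists of \<open>{i}\<close> and the finite subsets of \<open>{a. {i} \<Turnstile>\<^sub>i a}\<close>, so this
  set can serve as \<open>P\<^sub>i\<close>, and a relation between formulas is recovered by reading off their atoms.
  The empty conjunction is \<open>\<top>\<close>, for which the truth element is needed. Both passages are inverse to
  each other on objects and arrows and respect composition, because finitely many arrows of a
  composite always factor through a common intermediate pair.\<close>

section \<open>Transport of categories\<close>

text \<open>Since \<open>Fm\<close> and \<open>Gm\<close> are mutually inverse and \<open>Gm\<close>
  preserves identities and composition, those of \<open>C\<close> are transported from
  \<open>D\<close>. The category laws are therefore checked on one side and carried over to the
  other.\<close>

lemma isomorphic_categoriesI:
  assumes D: "category D"
    and Fo: "\<And>X. X \<in> Obj C \<Longrightarrow> Fo X \<in> Obj D"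
    and Go: "\<And>X. X \<in> Obj D \<Longrightarrow> Go X \<in> Obj C"
    and GoFo: "\<And>X. X \<in> Obj C \<Longrightarrow> Go (Fo X) = X"
    and FoGo: "\<And>X. X \<in> Obj D \<Longrightarrow> Fo (Go X) = X"
    and Fm: "\<And>X Y f. \<lbrakk>X \<in> Obj C; Y \<in> Obj C; f \<in> Hom C X Y\<rbrakk> \<Longrightarrow> Fm X Y f \<in> Hom D (Fo X) (Fo Y)"
    and Gm: "\<And>X Y g. \<lbrakk>X \<in> Obj D; Y \<in> Obj D; g \<in> Hom D X Y\<rbrakk> \<Longrightarrow> Gm X Y g \<in> Hom C (Go X) (Go Y)"
    and GmFm: "\<And>X Y f. \<lbrakk>X \<in> Obj C; Y \<in> Obj C; f \<in> Hom C X Y\<rbrakk>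
      \<Longrightarrow> Gm (Fo X) (Fo Y) (Fm X Y f) = f"
    and FmGm: "\<And>X Y g. \<lbrakk>X \<in> Obj D; Y \<in> Obj D; g \<in> Hom D X Y\<rbrakk>
      \<Longrightarrow> Fm (Go X) (Go Y) (Gm X Y g) = g"
    and Gm_Id: "\<And>X. X \<in> Obj D \<Longrightarrow> Gm X X (Id D X) = Id C (Go X)"
    and Gm_Comp: "\<And>X Y Z f g. \<lbrakk>X \<in> Obj D; Y \<in> Obj D; Z \<in> Obj D; f \<in> Hom D X Y; g \<in> Hom D Y Z\<rbrakk>
      \<Longrightarrow> Gm X Z (Comp D X Y Z f g) = Comp C (Go X) (Go Y) (Go Z) (Gm X Y f) (Gm Y Z g)"
  shows "isomorphic_categories C D"
proof -
  interpret D: category D by (rule D)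
  have Id: "Id C X = Gm (Fo X) (Fo X) (Id D (Fo X))" if "X \<in> Obj C" for X
    using Gm_Id[OF Fo[OF that]] GoFo[OF that] by simp
  have Comp: "Comp C X Y Z f g =
      Gm (Fo X) (Fo Z) (Comp D (Fo X) (Fo Y) (Fo Z) (Fm X Y f) (Fm Y Z g))"
    if "X \<in> Obj C" "Y \<in> Obj C" "Z \<in> Obj C" "f \<in> Hom C X Y" "g \<in> Hom C Y Z" for X Y Z f g
    using that by (simp add: Gm_Comp Fo Fm GmFm GoFo)
  \<comment> \<open>The inverse laws are restated at objects of the form \<open>Fo X\<close>, where
    \<open>Go (Fo X) = X\<close>; this is the shape that arises once \<open>Id\<close> and
    \<open>Comp\<close> of \<open>C\<close> are rewritten.\<close>
  have FmGm': "Fm X Y (Gm (Fo X) (Fo Y) g) = g"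
    if "X \<in> Obj C" "Y \<in> Obj C" "g \<in> Hom D (Fo X) (Fo Y)" for X Y g
    using FmGm[OF Fo Fo, of X Y g] that by (simp add: GoFo)
  have Gm': "Gm (Fo X) (Fo Y) g \<in> Hom C X Y"
    if "X \<in> Obj C" "Y \<in> Obj C" "g \<in> Hom D (Fo X) (Fo Y)" for X Y g
    using Gm[OF Fo Fo, of X Y g] that by (simp add: GoFo)
  have C: "category C"
    by standard
      (simp_all add: Id Comp Fo Fm Gm' FmGm' GmFm D.Id_in_Hom D.Comp_in_Hom D.Comp_Id_left
        D.Comp_Id_right D.Comp_assoc)
  interpret C: category C by (rule C)
  have "cat_functor C D Fo Fm"
    by standard (simp_all add: Id Comp Fo Fm FmGm' D.Id_in_Hom D.Comp_in_Hom)
  moreover have "cat_functor D C Go Gm"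
    by standard (simp_all add: Go Gm Gm_Id Gm_Comp)
  ultimately show ?thesis
    unfolding isomorphic_categories_def using GoFo FoGo GmFm FmGm by blast
qed

section \<open>The category of strong frames with truth elements\<close>

context cont_info_frame
begin

lemma Con_finite: "\<lbrakk>i \<in> Tok A; X \<in> Con A i\<rbrakk> \<Longrightarrow> finite X"
  and Con_Tok: "\<lbrakk>i \<in> Tok A; X \<in> Con A i\<rbrakk> \<Longrightarrow> X \<subseteq> Tok A"
  using Con_family by (auto simp: PiE_iff Fpow_def)

lemma Ent_Con: "\<lbrakk>i \<in> Tok A; entails A i X a\<rbrakk> \<Longrightarrow> X \<in> Con A i"
  and Ent_Tok: "\<lbrakk>i \<in> Tok A; entails A i X a\<rbrakk> \<Longrightarrow> a \<in> Tok A"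
  using Ent_family by (auto simp: PiE_iff)

lemma entails_set_Con:
  "\<lbrakk>i \<in> Tok A; X \<in> Con A i; finite Y; entails_set A i X Y\<rbrakk> \<Longrightarrow> Y \<in> Con A i"
  by (rule Con_Ent[of i Y X]) (auto simp: Fpow_def dest: Ent_Tok)

lemma entails_R: "\<lbrakk>i \<in> Tok A; entails A i X j\<rbrakk> \<Longrightarrow> frame_R A j i"
  by (rule entails_set_Con[of i X]) (auto dest: Ent_Con)

text \<open>Finiteness of \<open>Y\<close>, demanded by \<open>Ent_trans\<close>, is automatic: a
  set that entails something is consistent.\<close>

lemma Ent_cut:
  "\<lbrakk>i \<in> Tok A; X \<in> Con A i; entails_set A i X Y; entails A i Y a\<rbrakk> \<Longrightarrow> entails A i X a"
  by (rule Ent_trans[of i Y X a]) (auto simp: Fpow_def dest: Ent_Con Con_finite Con_Tok)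

text \<open>\<open>{j}\<close> is a finite entailed set, hence consistent at \<open>i\<close>. So
  \<open>frame_R A j i\<close> holds, and what is entailed at \<open>j\<close> is entailed at
  \<open>i\<close>.\<close>

lemma Ent_along:
  "\<lbrakk>i \<in> Tok A; entails A i X j; entails A j Y a\<rbrakk> \<Longrightarrow> entails A i Y a"
  by (rule R_Ent[of j i Y a]) (auto dest: Ent_Tok Ent_Con entails_R)

lemma interpolate:
  assumes "i \<in> Tok A" "X \<in> Con A i" "finite Y" "entails_set A i X Y"
  obtains e Z where "e \<in> Tok A" "Z \<in> Con A e" "entails_set A i X (insert e Z)"
    "entails_set A e Z Y"
proof -
  have "Y \<in> Fpow (Tok A)" using assms by (auto simp: Fpow_def dest: Ent_Tok)
  then show thesis using interpolation[of i Y X] assms that by auto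
qed

end

section \<open>Approximable families and one-sided interpolation\<close>

locale frame_morphism = dom: cont_info_frame A + cod: cont_info_frame A' +
    approximable_family A A' H
  for A :: "('a, 'z) frame_scheme" and A' :: "('b, 'y) frame_scheme" and H
begin

lemma rel_Con: "\<lbrakk>i \<in> Tok A; (X, b) \<in> H i\<rbrakk> \<Longrightarrow> X \<in> Con A i"
  and rel_Tok: "\<lbrakk>i \<in> Tok A; (X, b) \<in> H i\<rbrakk> \<Longrightarrow> b \<in> Tok A'"
  using family by (auto simp: PiE_iff)

lemma cut_right:
  assumes "i \<in> Tok A" "rel_set H i X (insert k Y)" "entails A' k Y b"
  shows "(X, b) \<in> H i"
proof (rule Ent_right[of i X k b Y])
  show "X \<in> Con A i" "k \<in> Tok A'" using assms rel_Con[of i X k] rel_Tok[of i X k] by auto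
  then show "b \<in> Tok A'" "Y \<in> Fpow (Tok A')"
    using assms cod.Ent_Tok[of k Y b] cod.Ent_Con[of k Y b] cod.Con_finite[of k Y]
      cod.Con_Tok[of k Y] by (auto simp: Fpow_def)
qed (use assms in auto)

lemma cut_left:
  "\<lbrakk>i \<in> Tok A; X \<in> Con A i; entails_set A i X Y; (Y, b) \<in> H i\<rbrakk> \<Longrightarrow> (X, b) \<in> H i"
  using Ent_left[of i X Y b] by (auto dest: rel_Con rel_Tok)

lemma weaken:
  "\<lbrakk>i \<in> Tok A; (X, b) \<in> H i; X \<subseteq> Y; Y \<in> Con A i\<rbrakk> \<Longrightarrow> (Y, b) \<in> H i"
  using mono[of i X Y b] by (auto dest: rel_Con rel_Tok)

lemma along:
  "\<lbrakk>i \<in> Tok A; entails A i X j; (Y, b) \<in> H j\<rbrakk> \<Longrightarrow> (Y, b) \<in> H i"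
  using R_mono[of j i Y b] by (auto dest: rel_Con rel_Tok dom.entails_R dom.Ent_Tok)

lemma interpolate:
  assumes "i \<in> Tok A" "X \<in> Con A i" "finite F" "rel_set H i X F"
  obtains c e U V where "c \<in> Tok A" "e \<in> Tok A'" "U \<in> Con A c" "V \<in> Con A' e"
    "entails_set A i X (insert c U)" "rel_set H c U (insert e V)" "entails_set A' e V F"
proof -
  have "F \<in> Fpow (Tok A')" using assms by (auto simp: Fpow_def dest: rel_Tok)
  then show thesis using interpolation[of i X F] assms that by auto
qed

text \<open>The left pair \<open>(c, U)\<close> of the interpolation axiom is absorbed: the
  instances at \<open>c\<close> move to \<open>i\<close> because \<open>c\<close> is entailed, and a
  cut then replaces \<open>U\<close> by \<open>X\<close>.\<close>

lemma interpolate_right: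
  assumes "i \<in> Tok A" "X \<in> Con A i" "finite F" "rel_set H i X F"
  obtains e V where "e \<in> Tok A'" "V \<in> Con A' e"
    "rel_set H i X (insert e V)" "entails_set A' e V F"
proof -
  obtain c e U V where *: "c \<in> Tok A" "e \<in> Tok A'" "U \<in> Con A c" "V \<in> Con A' e"
    "entails_set A i X (insert c U)" "rel_set H c U (insert e V)" "entails_set A' e V F"
    using interpolate[OF assms] by metis
  have "(X, b) \<in> H i" if "b \<in> insert e V" for b
    using * assms(1,2) that cut_left[of i X U b] along[of i X c U b] by auto
  then show thesis using that[OF *(2,4) _ *(7)] by blast
qed

text \<open>Dually, the right pair \<open>(e, V)\<close> is absorbed by
  \<open>cut_right\<close>.\<close>

lemma interpolate_left:
  assumes "i \<in> Tok A" "X \<in> Con A i" "finite F" "rel_set H i X F"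
  obtains c U where "c \<in> Tok A" "U \<in> Con A c"
    "entails_set A i X (insert c U)" "rel_set H c U F"
proof -
  obtain c e U V where *: "c \<in> Tok A" "e \<in> Tok A'" "U \<in> Con A c" "V \<in> Con A' e"
    "entails_set A i X (insert c U)" "rel_set H c U (insert e V)" "entails_set A' e V F"
    using interpolate[OF assms] by metis
  have "(U, b) \<in> H c" if "b \<in> F" for b
    using * that cut_right[of c e V U b] by auto
  then show thesis using that[OF *(1,3,5)] by blast
qed

end

lemma (in cont_info_frame) frame_morphism_Ent: "frame_morphism A A (Ent A)"
proof (intro frame_morphism.intro cont_info_frame_axioms, unfold_locales, goal_cases)
  case 1
  then show ?case by (rule Ent_family)
next
  case (2 i X k b Y)
  then show ?case
    using Ent_cut[of i X Y b] Ent_along[of i X k Y b] by auto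
next
  case (3 i X X' b)
  then show ?case by (blast intro: Ent_mono)
next
  case (4 i X X' b)
  then show ?case by (blast intro: Ent_cut)
next
  case (5 i j X b)
  then show ?case by (blast intro: R_Ent)
next
  case (6 i X F)
  then obtain e V where e: "e \<in> Tok A" "V \<in> Con A e" "entails_set A i X (insert e V)"
    "entails_set A e V F"
    using interpolate[of i X F] by (auto simp: Fpow_def)
  \<comment> \<open>An approximable family needs two intermediate pairs, but a frame interpolates
    one at a time. The second is inserted between \<open>X\<close> and the finite set
    \<open>insert e V\<close>.\<close>
  then obtain c U where "c \<in> Tok A" "U \<in> Con A c" "entails_set A i X (insert c U)"
    "entails_set A c U (insert e V)"
    using interpolate[of i X "insert e V"] 6 Con_finite[of e V] by auto
  with e show ?case by (metis Un_insert_left sup_bot_left)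
qed

section \<open>Composition of approximable families\<close>

lemma comp_families_iff:
  "i \<in> Tok A \<Longrightarrow> (X, a) \<in> comp_families A A' A'' G H i \<longleftrightarrow>
    X \<in> Con A i \<and> a \<in> Tok A'' \<and>
    (\<exists>e \<in> Tok A'. \<exists>V \<in> Con A' e. rel_set G i X (insert e V) \<and> (V, a) \<in> H e)"
  by (simp add: comp_families_def)

locale composable = G: frame_morphism A A' G + H: frame_morphism A' A'' H
  for A :: "('a, 'x) frame_scheme" and A' :: "('b, 'y) frame_scheme"
    and A'' :: "('c, 'z) frame_scheme" and G H
begin

abbreviation "GH \<equiv> comp_families A A' A'' G H"

lemma comp_intro:
  assumes "i \<in> Tok A" "e \<in> Tok A'" "rel_set G i X (insert e V)" "(V, a) \<in> H e"
  shows "(X, a) \<in> GH i"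
proof -
  have "X \<in> Con A i" "a \<in> Tok A''" "V \<in> Con A' e"
    using assms by (auto intro: G.rel_Con H.rel_Con H.rel_Tok)
  then show ?thesis
    using assms unfolding comp_families_iff[OF assms(1)] by blast
qed

lemma comp_common:
  assumes i: "i \<in> Tok A" and X: "X \<in> Con A i" and F: "finite F" "rel_set GH i X F"
  obtains e V where "e \<in> Tok A'" "V \<in> Con A' e" "rel_set G i X (insert e V)" "rel_set H e V F"
proof -
  have "\<forall>b \<in> F. \<exists>e V. e \<in> Tok A' \<and> V \<in> Con A' e \<and> rel_set G i X (insert e V) \<and> (V, b) \<in> H e"
    using F(2) i unfolding comp_families_iff[OF i] by blast
  then obtain e V where eV: "e b \<in> Tok A'" "V b \<in> Con A' (e b)"
      "rel_set G i X (insert (e b) (V b))" "(V b, b) \<in> H (e b)" if "b \<in> F" for b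
    by metis
  text \<open>Interpolating \<open>G\<close> at the union of the individual witnesses produces one pair above all of
    them.\<close>
  define W where "W = (\<Union>b \<in> F. insert (e b) (V b))"
  have "finite W" using F(1) eV(1,2) by (auto simp: W_def intro: G.cod.Con_finite)
  moreover have "rel_set G i X W" using eV by (auto simp: W_def)
  ultimately obtain e' V' where *: "e' \<in> Tok A'" "V' \<in> Con A' e'" "rel_set G i X (insert e' V')"
      "entails_set A' e' V' W"
    using G.interpolate_right[OF i X] by metis
  \<comment> \<open>The instance at \<open>e b\<close> moves to \<open>e'\<close>, where
    \<open>e b\<close> is entailed by \<open>V'\<close>; then \<open>V b\<close> is cut against
    \<open>V'\<close>.\<close>
  have "(V', b) \<in> H e'" if "b \<in> F" for b
  proof -
    have "entails A' e' V' (e b)" "entails_set A' e' V' (V b)"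
      using * that by (auto simp: W_def)
    then show ?thesis
      using * eV[OF that] H.along[of e' V' "e b" "V b" b] H.cut_left[of e' V' "V b" b] by blast
  qed
  with * that show thesis by blast
qed

lemma frame_morphism_comp: "frame_morphism A A'' GH"
proof (intro frame_morphism.intro G.dom.cont_info_frame_axioms H.cod.cont_info_frame_axioms,
    unfold_locales, goal_cases)
  case 1
  then show ?case by (auto simp: comp_families_def)
next
  case (2 i X k b Y)
  then have "finite (insert k Y)" by (auto simp: Fpow_def)
  with 2 obtain e V where "e \<in> Tok A'" "V \<in> Con A' e" "rel_set G i X (insert e V)"
      "rel_set H e V (insert k Y)"
    using comp_common[of i X "insert k Y"] by auto
  then show ?case
    using 2 H.cut_right[of e k Y V b] by (blast intro: comp_intro)
next
  case (3 i X X' b)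
  then obtain e V where "e \<in> Tok A'" "rel_set G i X (insert e V)" "(V, b) \<in> H e"
    unfolding comp_families_iff[OF 3(1)] by blast
  with 3 show ?case by (blast intro: comp_intro G.weaken)
next
  case (4 i X X' b)
  then obtain e V where "e \<in> Tok A'" "rel_set G i X' (insert e V)" "(V, b) \<in> H e"
    unfolding comp_families_iff[OF 4(1)] by blast
  with 4 show ?case by (blast intro: comp_intro G.cut_left)
next
  case (5 i j X b)
  then obtain e V where "e \<in> Tok A'" "rel_set G i X (insert e V)" "(V, b) \<in> H e"
    unfolding comp_families_iff[OF 5(1)] by blast
  moreover from this 5 have "rel_set G j X (insert e V)"
    by (auto intro: G.R_mono[of i j] G.rel_Tok[of i])
  ultimately show ?case
    using 5 comp_intro[of j e V X b] by blast
next
  \<comment> \<open>First \<open>H\<close> is interpolated at \<open>e\<close>, then its left pair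
    \<open>(c', U')\<close> is pulled back to \<open>X\<close> through \<open>G\<close>, and finally
    \<open>G\<close> is interpolated on the left. The pair \<open>(c', U')\<close> becomes the
    witness for the composite at \<open>c\<close>.\<close>
  case (6 i X F)
  then obtain e V where e: "e \<in> Tok A'" "V \<in> Con A' e" "rel_set G i X (insert e V)"
      "rel_set H e V F"
    using comp_common[of i X F] by (auto simp: Fpow_def)
  with 6 obtain c' e' U' V' where *: "c' \<in> Tok A'" "e' \<in> Tok A''" "U' \<in> Con A' c'"
      "V' \<in> Con A'' e'" "entails_set A' e V (insert c' U')" "rel_set H c' U' (insert e' V')"
      "entails_set A'' e' V' F"
    using H.interpolate[of e V F] unfolding Fpow_def by blast
  have "rel_set G i X (insert c' U')"
    using e * 6 G.cut_right[of i e V X] by blast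
  then obtain c U where "c \<in> Tok A" "U \<in> Con A c" "entails_set A i X (insert c U)"
      "rel_set G c U (insert c' U')"
    using G.interpolate_left[of i X "insert c' U'"] 6 * G.cod.Con_finite[of c' U'] by auto
  moreover from this have "rel_set GH c U (insert e' V')"
    using * comp_intro[of c c' U' U] by blast
  ultimately show ?case
    using * by (metis Un_insert_left sup_bot_left)
qed

end

section \<open>Truth elements and the category laws for frames\<close>

locale truth_frame = strong_cont_info_frame A for A :: "'a truth_frame" +
  assumes truth: "truth_element A (Truth A)"

locale truth_morphism = frame_morphism A A' H + dom: truth_frame A + cod: truth_frame A'
  for A A' :: "'a truth_frame" and H +
  assumes respects_truth: "({}, Truth A') \<in> H (Truth A)"

lemma Obj_SIFt: "A \<in> Obj SIFt \<longleftrightarrow> truth_frame A"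
  by (simp add: SIFt_def truth_frame_def truth_frame_axioms_def)

lemma Hom_SIFt:
  assumes "A \<in> Obj SIFt" "A' \<in> Obj SIFt"
  shows "H \<in> Hom SIFt A A' \<longleftrightarrow> truth_morphism A A' H"
proof -
  have "H \<in> Hom SIFt A A' \<longleftrightarrow> approximable_family A A' H \<and> ({}, Truth A') \<in> H (Truth A)"
    by (simp add: SIFt_def)
  then show ?thesis
    using assms unfolding Obj_SIFt truth_morphism_def truth_morphism_axioms_def frame_morphism_def
      truth_frame_def strong_cont_info_frame_def by blast
qed

context truth_frame
begin

lemma Truth_Tok: "Truth A \<in> Tok A"
  and Truth_Ent: "i \<in> Tok A \<Longrightarrow> entails A i {} (Truth A)"
  using truth by (auto simp: truth_element_def)

lemma Ent_Truth: "\<lbrakk>i \<in> Tok A; X \<in> Con A i\<rbrakk> \<Longrightarrow> entails A i X (Truth A)"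
  using Ent_mono[of i "{}" X] Truth_Ent[of i] Ent_Con[of i "{}"] by blast

end

text \<open>The defining condition concerns the index \<open>Truth A\<close> alone. It spreads to
  every \<open>i\<close> because \<open>{}\<close> entails \<open>Truth A\<close> at
  \<open>i\<close>, and then to \<open>X\<close> by monotonicity.\<close>

lemma (in truth_morphism) rel_Truth:
  assumes "i \<in> Tok A" "X \<in> Con A i"
  shows "(X, Truth A') \<in> H i"
proof -
  have "({}, Truth A') \<in> H i"
    using along[OF assms(1) dom.Truth_Ent[OF assms(1)] respects_truth] .
  then show ?thesis using weaken[OF assms(1) _ _ assms(2)] by simp
qed

text \<open>In the left-bracketed composite the tokens of \<open>insert e V\<close> come with
  individual witnesses in \<open>B\<close>, which \<open>comp_common\<close> merges into one pair.
  In the right-bracketed one the pair in \<open>B\<close> is common from the start.\<close>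

lemma comp_families_assoc:
  assumes "frame_morphism A B F" "frame_morphism B C G" "frame_morphism C D H"
  shows "comp_families A C D (comp_families A B C F G) H =
    comp_families A B D F (comp_families B C D G H)"
proof (rule ext)
  fix i
  interpret FG: composable A B C F G using assms by (intro composable.intro)
  interpret GH: composable B C D G H using assms by (intro composable.intro)
  interpret FG_H: composable A C D FG.GH H
    using assms FG.frame_morphism_comp by (intro composable.intro)
  interpret F_GH: composable A B D F GH.GH
    using assms GH.frame_morphism_comp by (intro composable.intro)
  show "FG_H.GH i = F_GH.GH i"
  proof (cases "i \<in> Tok A")
    case False
    then show ?thesis by (simp add: comp_families_def)
  next
    case i: True
    have "(X, a) \<in> F_GH.GH i" if Xa: "(X, a) \<in> FG_H.GH i" for X a
    proof -
      obtain e V where e: "X \<in> Con A i" "e \<in> Tok C" "V \<in> Con C e"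
          "rel_set FG.GH i X (insert e V)" "(V, a) \<in> H e"
        using Xa unfolding comp_families_iff[OF i, where G = FG.GH and H = H] by blast
      then have "finite (insert e V)"
        using FG.H.cod.Con_finite by auto
      then obtain e' V' where "e' \<in> Tok B" "V' \<in> Con B e'" "rel_set F i X (insert e' V')"
          "rel_set G e' V' (insert e V)"
        using FG.comp_common[OF i e(1) _ e(4)] by blast
      moreover from this have "(V', a) \<in> GH.GH e'"
        using e GH.comp_intro[of e' e V V' a] by blast
      ultimately show ?thesis using i F_GH.comp_intro[of i e' V' X a] by blast
    qed
    moreover have "(X, a) \<in> FG_H.GH i" if Xa: "(X, a) \<in> F_GH.GH i" for X a
    proof -
      obtain e V where e: "e \<in> Tok B" "rel_set F i X (insert e V)" "(V, a) \<in> GH.GH e"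
        using Xa unfolding comp_families_iff[OF i] by blast
      then obtain e' V' where "e' \<in> Tok C" "rel_set G e V (insert e' V')" "(V', a) \<in> H e'"
        unfolding comp_families_iff[OF e(1)] by blast
      moreover from this have "rel_set FG.GH i X (insert e' V')"
        using e i FG.comp_intro[of i e V X] by blast
      ultimately show ?thesis using i FG_H.comp_intro[of i e' V' X a] by blast
    qed
    ultimately show ?thesis by auto
  qed
qed

context frame_morphism
begin

lemma extensional_eqI:
  assumes "K \<in> extensional (Tok A)" "\<And>i X b. i \<in> Tok A \<Longrightarrow> (X, b) \<in> K i \<longleftrightarrow> (X, b) \<in> H i"
  shows "K = H"
  using family assms by (intro extensionalityI[of _ "Tok A"]) (auto simp: PiE_def)

text \<open>An identity is removed by \<open>along\<close> and a cut, and introduced by one-sided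
  interpolation.\<close>

lemma comp_families_Ent_left: "comp_families A A A' (Ent A) H = H"
proof (rule extensional_eqI, goal_cases)
  case 1
  then show ?case by (simp add: comp_families_def)
next
  case (2 i X b)
  interpret composable A A A' "Ent A" H
    using dom.frame_morphism_Ent frame_morphism_axioms by (rule composable.intro)
  show ?case
  proof
    assume "(X, b) \<in> comp_families A A A' (Ent A) H i"
    then obtain e V where e: "X \<in> Con A i" "entails_set A i X (insert e V)" "(V, b) \<in> H e"
      unfolding comp_families_iff[OF 2] by blast
    then show "(X, b) \<in> H i"
      using cut_left[of i X V b] along[of i X e V b] 2 by blast
  next
    assume b: "(X, b) \<in> H i"
    then obtain c U where "c \<in> Tok A" "entails_set A i X (insert c U)" "(U, b) \<in> H c"
      using interpolate_left[of i X "{b}"] 2 rel_Con by auto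
    then show "(X, b) \<in> comp_families A A A' (Ent A) H i"
      using 2 by (meson comp_intro)
  qed
qed

lemma comp_families_Ent_right: "comp_families A A' A' H (Ent A') = H"
proof (rule extensional_eqI, goal_cases)
  case 1
  then show ?case by (simp add: comp_families_def)
next
  case (2 i X b)
  interpret composable A A' A' H "Ent A'"
    using frame_morphism_axioms cod.frame_morphism_Ent by (rule composable.intro)
  show ?case
  proof
    assume "(X, b) \<in> comp_families A A' A' H (Ent A') i"
    then obtain e V where e: "rel_set H i X (insert e V)" "entails A' e V b"
      unfolding comp_families_iff[OF 2] by blast
    then show "(X, b) \<in> H i"
      using cut_right[of i e V X b] 2 by blast
  next
    assume b: "(X, b) \<in> H i"
    then obtain e V where "e \<in> Tok A'" "rel_set H i X (insert e V)" "entails A' e V b"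
      using interpolate_right[of i X "{b}"] 2 b rel_Con
      by (metis finite.emptyI finite.insertI singletonD singletonI)
    then show "(X, b) \<in> comp_families A A' A' H (Ent A') i"
      using 2 by (meson comp_intro)
  qed
qed

end

lemma (in truth_frame) truth_morphism_Ent: "truth_morphism A A (Ent A)"
  by (intro truth_morphism.intro truth_morphism_axioms.intro frame_morphism_Ent
      truth_frame_axioms Truth_Ent Truth_Tok)

lemma truth_morphism_comp:
  assumes "truth_morphism A B G" "truth_morphism B C H"
  shows "truth_morphism A C (comp_families A B C G H)"
proof -
  interpret G: truth_morphism A B G by fact
  interpret H: truth_morphism B C H by fact
  interpret composable A B C G H ..
  show ?thesis
    using comp_intro[of "Truth A" "Truth B" "{}" "{}" "Truth C"] G.respects_truth H.respects_truth
    by (intro truth_morphism.intro truth_morphism_axioms.intro frame_morphism_comp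
        G.dom.truth_frame_axioms H.cod.truth_frame_axioms)
      (auto simp: G.dom.Truth_Tok G.cod.Truth_Tok)
qed

lemma Id_SIFt: "Id SIFt = Ent"
  and Comp_SIFt: "Comp SIFt = comp_families"
  by (simp_all add: SIFt_def)

lemma category_SIFt: "category SIFt"
proof (standard, goal_cases)
  case (1 X)
  then show ?case
    by (simp add: Hom_SIFt Id_SIFt Obj_SIFt truth_frame.truth_morphism_Ent)
next
  case (2 X Y Z f g)
  then show ?case
    by (simp add: Hom_SIFt Comp_SIFt) (blast intro: truth_morphism_comp)
next
  case (3 X Y f)
  then interpret truth_morphism X Y f by (simp add: Hom_SIFt)
  show ?case by (simp add: Id_SIFt Comp_SIFt comp_families_Ent_left)
next
  case (4 X Y f)
  then interpret truth_morphism X Y f by (simp add: Hom_SIFt)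
  show ?case by (simp add: Id_SIFt Comp_SIFt comp_families_Ent_right)
next
  case (5 W X Y Z f g h)
  then show ?case
    by (simp add: Hom_SIFt Comp_SIFt comp_families_assoc truth_morphism_def)
qed

section \<open>Atoms of formulas and antecedents\<close>

lemma finite_atoms: "finite (atoms \<phi>)"
  by (induction \<phi>) auto

lemma ex_form_atoms:
  assumes "finite X" "X \<noteq> {}"
  shows "\<exists>\<phi>. atoms \<phi> = X"
  using assms
proof (induction rule: finite_ne_induct)
  case (singleton a)
  have "atoms (Atom a) = {a}" by simp
  then show ?case ..
next
  case (insert a X)
  then obtain \<phi> where "atoms \<phi> = X" by blast
  then have "atoms (And (Atom a) \<phi>) = insert a X" by simp
  then show ?case ..
qed

definition props :: "'a form set \<Rightarrow> 'a set" where
  "props \<Gamma> = \<Union> (atoms ` \<Gamma>)"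

lemma props_simps [simp]:
  "props {} = {}" "props (insert \<phi> \<Gamma>) = atoms \<phi> \<union> props \<Gamma>"
  "props (\<Gamma> \<union> \<Delta>) = props \<Gamma> \<union> props \<Delta>" "props (Atom ` X) = X"
  by (auto simp: props_def)

lemma Fpow_Lang: "\<Gamma> \<in> Fpow (Lang Q) \<longleftrightarrow> finite \<Gamma> \<and> props \<Gamma> \<subseteq> Q"
  by (auto simp: Fpow_def Lang_def props_def)

lemma finite_props: "finite \<Gamma> \<Longrightarrow> finite (props \<Gamma>)"
  by (simp add: props_def finite_atoms)

text \<open>\<open>Antecedents\<close> with the stratum as a parameter, so that it applies both to
  \<open>Str P p\<close> and to a set of tokens of a frame.\<close>

definition antecedents :: "'a set \<Rightarrow> 'a \<Rightarrow> 'a form set set" where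
  "antecedents Q p = Fpow (Lang Q) \<union> {{Atom p}}"

lemma props_antecedents: "\<Gamma> \<in> antecedents Q p \<Longrightarrow> props \<Gamma> \<in> Fpow Q \<union> {{p}}"
  by (auto simp: antecedents_def Fpow_Lang) (auto simp: Fpow_def finite_props)

lemma Atom_image_antecedents: "Atom ` X \<in> antecedents Q p \<longleftrightarrow> X \<in> Fpow Q \<union> {{p}}"
proof -
  have "Atom ` X = {Atom p} \<longleftrightarrow> X = {p}"
    by (metis image_empty image_insert form.inject(1) inj_image_eq_iff inj_onI)
  moreover have "finite (Atom ` X) \<longleftrightarrow> finite X"
    by (rule finite_image_iff) (simp add: inj_on_def)
  then have "Atom ` X \<in> Fpow (Lang Q) \<longleftrightarrow> X \<in> Fpow Q"
    unfolding Fpow_Lang by (auto simp: Fpow_def)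
  ultimately show ?thesis by (simp add: antecedents_def)
qed

lemma singleton_antecedents: "{\<psi>} \<in> antecedents Q p \<longleftrightarrow> \<psi> \<in> Lang Q \<union> {Atom p}"
  unfolding antecedents_def Un_iff Fpow_Lang by (auto simp: Lang_def)

lemma Antecedents_eq: "Antecedents P p = antecedents (Str P p) p"
  by (simp add: Antecedents_def antecedents_def)

section \<open>Passing between relations on atoms and relations on formulas\<close>

definition atomic_rel :: "'a set \<Rightarrow> 'a csl_rel \<Rightarrow> ('a, 'a) rel_family" where
  "atomic_rel I S = (\<lambda>p \<in> I. {(X, a). (Atom ` X, Atom a) \<in> S p})"

text \<open>The family \<open>Q\<close> fixes the admissible antecedents. With \<open>I\<close> and
  \<open>Q\<close> as parameters, the same definition produces both the provability relations of a
  logic and the arrows between logics.\<close>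

definition formula_rel :: "'a set \<Rightarrow> ('a \<Rightarrow> 'a set) \<Rightarrow> ('a, 'a) rel_family \<Rightarrow> 'a csl_rel" where
  "formula_rel I Q H = (\<lambda>p \<in> I. {(\<Gamma>, \<phi>). \<Gamma> \<in> antecedents (Q p) p \<and>
     (\<forall>a \<in> atoms \<phi>. (props \<Gamma>, a) \<in> H p)})"

lemma atomic_rel_iff: "p \<in> I \<Longrightarrow> (X, a) \<in> atomic_rel I S p \<longleftrightarrow> (Atom ` X, Atom a) \<in> S p"
  by (simp add: atomic_rel_def)

lemma formula_rel_iff:
  "p \<in> I \<Longrightarrow> (\<Gamma>, \<phi>) \<in> formula_rel I Q H p \<longleftrightarrow>
    \<Gamma> \<in> antecedents (Q p) p \<and> (\<forall>a \<in> atoms \<phi>. (props \<Gamma>, a) \<in> H p)"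
  by (simp add: formula_rel_def)

text \<open>\<open>props\<close> inverts the image under \<open>Atom\<close>, and by the second
  assumption every antecedent occurring in \<open>H\<close> is admissible, so the restriction to
  \<open>antecedents\<close> loses nothing.\<close>

lemma atomic_rel_formula_rel:
  assumes "H \<in> extensional I" "\<And>p X a. \<lbrakk>p \<in> I; (X, a) \<in> H p\<rbrakk> \<Longrightarrow> X \<in> Fpow (Q p) \<union> {{p}}"
  shows "atomic_rel I (formula_rel I Q H) = H"
proof (rule extensionalityI[of _ I])
  show "atomic_rel I (formula_rel I Q H) \<in> extensional I" by (simp add: atomic_rel_def)
  show "atomic_rel I (formula_rel I Q H) p = H p" if "p \<in> I" for p
    using that assms(2)
    by (auto simp del: Un_iff simp: atomic_rel_iff formula_rel_iff Atom_image_antecedents)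
qed (rule assms(1))

text \<open>The element \<open>t\<close> is needed since a formula has at least one atom.\<close>

lemma antecedent_formula:
  assumes "X \<in> Fpow Q \<union> {{p}}" "t \<in> Q"
  obtains \<psi> where "{\<psi>} \<in> antecedents Q p" "X \<subseteq> atoms \<psi>" "atoms \<psi> \<subseteq> insert t X"
proof (cases "X \<in> Fpow Q")
  case True
  then obtain \<psi> where "atoms \<psi> = insert t X"
    using ex_form_atoms[of "insert t X"] by (auto simp: Fpow_def)
  with True that[of \<psi>] assms(2) show thesis
    by (auto simp: singleton_antecedents Lang_def Fpow_def)
next
  case False
  with assms(1) that[of "Atom p"] show thesis by (simp add: singleton_antecedents)
qed

text \<open>The part of the rules shared by the provability relations and the global consequence
  relations, at a single index \<open>p\<close>.\<close>

locale conj_rel =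
  fixes Q :: "'a set" and p :: 'a and R :: "('a form set \<times> 'a form) set"
  assumes dom: "(\<Gamma>, \<phi>) \<in> R \<Longrightarrow> \<Gamma> \<in> antecedents Q p"
    and W: "\<lbrakk>\<Delta> \<in> Fpow (Lang Q); \<xi> \<in> Lang Q; (\<Delta>, \<phi>) \<in> R\<rbrakk> \<Longrightarrow> (\<Delta> \<union> {\<xi>}, \<phi>) \<in> R"
    and L_And: "\<lbrakk>\<Delta> \<in> Fpow (Lang Q); \<phi> \<in> Lang Q; \<psi> \<in> Lang Q\<rbrakk>
      \<Longrightarrow> (\<Delta> \<union> {\<phi>, \<psi>}, \<theta>) \<in> R \<longleftrightarrow> (\<Delta> \<union> {And \<phi> \<psi>}, \<theta>) \<in> R"
    and R_And: "\<Gamma> \<in> antecedents Q p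
      \<Longrightarrow> (\<Gamma>, \<phi>) \<in> R \<and> (\<Gamma>, \<psi>) \<in> R \<longleftrightarrow> (\<Gamma>, And \<phi> \<psi>) \<in> R"
begin

lemma W_set:
  assumes "\<Delta> \<in> Fpow (Lang Q)" "\<Xi> \<in> Fpow (Lang Q)" "(\<Delta>, \<phi>) \<in> R"
  shows "(\<Delta> \<union> \<Xi>, \<phi>) \<in> R"
proof -
  have "finite \<Xi>" "\<Xi> \<subseteq> Lang Q" using assms(2) by (auto simp: Fpow_def)
  then show ?thesis
  proof (induction rule: finite_induct)
    case empty
    then show ?case using assms by simp
  next
    case (insert \<xi> \<Xi>)
    then have "\<Delta> \<union> \<Xi> \<in> Fpow (Lang Q)" using assms(1) by (auto simp: Fpow_def)
    with insert W[of "\<Delta> \<union> \<Xi>" \<xi> \<phi>] show ?case by simp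
  qed
qed

text \<open>Induction with (L\<and>). The context stays arbitrary because the conjuncts are
  decomposed one after the other, each with the other in the context.\<close>

lemma formula_iff_atoms:
  "\<lbrakk>\<Delta> \<in> Fpow (Lang Q); \<phi> \<in> Lang Q\<rbrakk>
    \<Longrightarrow> (\<Delta> \<union> {\<phi>}, \<theta>) \<in> R \<longleftrightarrow> (\<Delta> \<union> Atom ` atoms \<phi>, \<theta>) \<in> R"
proof (induction \<phi> arbitrary: \<Delta>)
  case (Atom a)
  then show ?case by simp
next
  case (And \<phi> \<psi>)
  have in_Lang: "\<phi> \<in> Lang Q" "\<psi> \<in> Lang Q" using And.prems by (auto simp: Lang_def)
  have "\<Delta> \<union> {\<phi>} \<in> Fpow (Lang Q)" "\<Delta> \<union> Atom ` atoms \<psi> \<in> Fpow (Lang Q)"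
    using And.prems by (auto simp: Fpow_def finite_atoms Lang_def)
  note IH = And.IH(1)[OF this(2) in_Lang(1)] And.IH(2)[OF this(1) in_Lang(2)]
  have "(\<Delta> \<union> {And \<phi> \<psi>}, \<theta>) \<in> R \<longleftrightarrow> ((\<Delta> \<union> {\<phi>}) \<union> {\<psi>}, \<theta>) \<in> R"
    using L_And[OF And.prems(1) in_Lang] by (simp add: insert_commute)
  also have "\<dots> \<longleftrightarrow> ((\<Delta> \<union> Atom ` atoms \<psi>) \<union> {\<phi>}, \<theta>) \<in> R"
    using IH(2) by simp
  also have "\<dots> \<longleftrightarrow> (\<Delta> \<union> Atom ` atoms (And \<phi> \<psi>), \<theta>) \<in> R"
    using IH(1) by (simp add: image_Un Un_ac)
  finally show ?case .
qed

text \<open>The exceptional antecedent \<open>{Atom p}\<close> already consists of atoms. Any other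
  is a finite set of formulas over \<open>Q\<close>, to which \<open>formula_iff_atoms\<close>
  applies one formula at a time.\<close>

lemma antecedent_iff_props:
  assumes "\<Gamma> \<in> antecedents Q p"
  shows "(\<Gamma>, \<theta>) \<in> R \<longleftrightarrow> (Atom ` props \<Gamma>, \<theta>) \<in> R"
proof (cases "\<Gamma> = {Atom p}")
  case False
  have "(\<Delta> \<union> \<Gamma>, \<theta>) \<in> R \<longleftrightarrow> (\<Delta> \<union> Atom ` props \<Gamma>, \<theta>) \<in> R"
    if "finite \<Gamma>" "\<Gamma> \<subseteq> Lang Q" "\<Delta> \<in> Fpow (Lang Q)" for \<Delta> \<Gamma>
    using that
  proof (induction arbitrary: \<Delta> rule: finite_induct)
    case (insert \<phi> \<Gamma>)
    then have "\<Delta> \<union> {\<phi>} \<in> Fpow (Lang Q)" "\<Delta> \<union> Atom ` props \<Gamma> \<in> Fpow (Lang Q)"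
      by (auto simp: Fpow_Lang finite_props) (auto simp: Lang_def props_def)
    \<comment> \<open>The rest of the antecedent is decomposed with \<open>\<phi>\<close> in the
      context, then \<open>\<phi>\<close> with the resulting atoms in the context.\<close>
    with insert.IH[of "\<Delta> \<union> {\<phi>}"] formula_iff_atoms[of "\<Delta> \<union> Atom ` props \<Gamma>" \<phi> \<theta>] insert.prems
    show ?case by (simp add: image_Un Un_ac)
  qed simp
  from this[of \<Gamma> "{}"] show ?thesis
    using assms False by (auto simp: antecedents_def Fpow_def)
qed simp

text \<open>(R\<and>) decomposes the right side and \<open>antecedent_iff_props\<close> the left.
  This is why \<open>formula_rel\<close> undoes \<open>atomic_rel\<close>.\<close>

lemma rel_iff_atomic:
  "(\<Gamma>, \<phi>) \<in> R \<longleftrightarrow>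
    \<Gamma> \<in> antecedents Q p \<and> (\<forall>a \<in> atoms \<phi>. (Atom ` props \<Gamma>, Atom a) \<in> R)"
proof (cases "\<Gamma> \<in> antecedents Q p")
  case True
  have "(\<Gamma>, \<phi>) \<in> R \<longleftrightarrow> (\<forall>a \<in> atoms \<phi>. (\<Gamma>, Atom a) \<in> R)"
    by (induction \<phi>) (auto simp: R_And[OF True, symmetric])
  then show ?thesis using True antecedent_iff_props by simp
qed (auto dest: dom)

end

section \<open>The frame of a logic\<close>

text \<open>\<open>{p}\<close> is added because \<open>p\<close> need not lie in its own stratum;
  with it, \<open>Con\<close> collects exactly the sets of atoms that form admissible
  antecedents.\<close>

definition logic_frame :: "'a csl \<Rightarrow> 'a truth_frame" where
  "logic_frame P = \<lparr>Tok = Prp P, Con = (\<lambda>p \<in> Prp P. Fpow (Str P p) \<union> {{p}}),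
     Ent = atomic_rel (Prp P) (Prv P), Truth = Top P\<rparr>"

lemma logic_frame_simps [simp]:
  "Tok (logic_frame P) = Prp P" "Ent (logic_frame P) = atomic_rel (Prp P) (Prv P)"
  "Truth (logic_frame P) = Top P"
  by (simp_all add: logic_frame_def)

lemma Con_logic_frame:
  "p \<in> Prp P \<Longrightarrow> Con (logic_frame P) p = Fpow (Str P p) \<union> {{p}}"
  by (simp add: logic_frame_def)

lemma Con_logic_frame_iff:
  "p \<in> Prp P \<Longrightarrow> X \<in> Con (logic_frame P) p \<longleftrightarrow> Atom ` X \<in> Antecedents P p"
  by (simp add: Antecedents_eq Atom_image_antecedents Con_logic_frame)

context cont_strat_conj_logic
begin

lemma Str_Prp: "p \<in> Prp P \<Longrightarrow> Str P p \<subseteq> Prp P"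
  using Str_family by (auto simp: PiE_iff)

lemma proves_Antecedents: "\<lbrakk>p \<in> Prp P; proves P p \<Gamma> \<phi>\<rbrakk> \<Longrightarrow> \<Gamma> \<in> Antecedents P p"
  and proves_LangAt: "\<lbrakk>p \<in> Prp P; proves P p \<Gamma> \<phi>\<rbrakk> \<Longrightarrow> \<phi> \<in> LangAt P p"
  using Prv_family by (auto simp: PiE_iff)

lemma proves_Str: "\<lbrakk>p \<in> Prp P; proves P p \<Gamma> (Atom a)\<rbrakk> \<Longrightarrow> a \<in> Str P p"
  using proves_LangAt[of p \<Gamma> "Atom a"] by (simp add: Lang_def)

lemma Top_Str: "p \<in> Prp P \<Longrightarrow> Top P \<in> Str P p"
  by (rule proves_Str[OF _ R_Top[of p "{}"]]) (auto simp: Antecedents_def Fpow_def)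

lemma conj_rel_Prv: "p \<in> Prp P \<Longrightarrow> conj_rel (Str P p) p (Prv P p)"
  by standard (auto simp: W L_And R_And Antecedents_eq[symmetric] proves_Antecedents
      simp del: Un_insert_right)

lemma proves_iff:
  "p \<in> Prp P \<Longrightarrow> proves P p \<Gamma> \<phi> \<longleftrightarrow>
    \<Gamma> \<in> Antecedents P p \<and> (\<forall>a \<in> atoms \<phi>. proves P p (Atom ` props \<Gamma>) (Atom a))"
  unfolding Antecedents_eq by (rule conj_rel.rel_iff_atomic[OF conj_rel_Prv])

text \<open>Adding \<open>\<top>\<close> makes a finite set of atoms nonempty, hence the set of atoms of a formula,
  without changing its consequences.\<close>

lemma conjunction_of:
  assumes p: "p \<in> Prp P" and X: "Atom ` X \<in> Antecedents P p"
    and Y: "finite Y" "\<And>b. b \<in> Y \<Longrightarrow> proves P p (Atom ` X) (Atom b)"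
  obtains \<phi> where "atoms \<phi> = insert (Top P) Y" "proves P p (Atom ` X) \<phi>" "\<phi> \<in> LangAt P p"
proof -
  obtain \<phi> where \<phi>: "atoms \<phi> = insert (Top P) Y"
    using ex_form_atoms[of "insert (Top P) Y"] Y(1) by auto
  have "proves P p (Atom ` X) \<phi>"
    using proves_iff[OF p, of "Atom ` X" \<phi>] X Y(2) R_Top[OF p X] by (simp add: \<phi>)
  with \<phi> that proves_LangAt[OF p] show thesis by blast
qed

end

text \<open>The cut rule is (Cut) for provability and (Lcut) for a global consequence relation, so
  cut and monotonicity for sets of atoms are proved once for both.\<close>

locale conj_rel_over = cont_strat_conj_logic P + conj_rel "Str P p" p R
  for P :: "'a csl" and p R +
  assumes p: "p \<in> Prp P"
    and Lcut: "\<lbrakk>proves P p \<Gamma> \<phi>; ({\<phi>}, \<psi>) \<in> R\<rbrakk> \<Longrightarrow> (\<Gamma>, \<psi>) \<in> R"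
begin

text \<open>The rule cuts a single formula, so \<open>Y\<close> is replaced by a conjunction with
  atoms \<open>insert (Top P) Y\<close>; weakening by \<top> adjusts the other premise to
  it.\<close>

lemma atomic_cut:
  assumes X: "Atom ` X \<in> Antecedents P p"
    and XY: "\<And>b. b \<in> Y \<Longrightarrow> proves P p (Atom ` X) (Atom b)" and Y: "(Atom ` Y, \<theta>) \<in> R"
  shows "(Atom ` X, \<theta>) \<in> R"
proof -
  \<comment> \<open>Provable atoms lie in the stratum, so \<open>Y\<close> is an ordinary context
    open to weakening, even if \<open>Y = {p}\<close>.\<close>
  have "Y \<subseteq> Str P p" using XY proves_Str[OF p] by blast
  moreover have "finite Y"
    using dom[OF Y] by (auto simp: Atom_image_antecedents Fpow_def)
  ultimately have "Atom ` Y \<in> Fpow (LangAt P p)" by (simp add: Fpow_Lang)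
  from W[OF this _ Y, of "Atom (Top P)"]
  have Top_Y: "(Atom ` insert (Top P) Y, \<theta>) \<in> R"
    using Top_Str[OF p] by (simp add: Lang_def)
  obtain \<phi> where \<phi>: "atoms \<phi> = insert (Top P) Y" "proves P p (Atom ` X) \<phi>" "\<phi> \<in> LangAt P p"
    using conjunction_of[OF p X \<open>finite Y\<close> XY] by blast
  have "({\<phi>}, \<theta>) \<in> R"
    using antecedent_iff_props[of "{\<phi>}" \<theta>] \<phi>(3) Top_Y by (simp add: singleton_antecedents \<phi>(1))
  with \<phi>(2) show ?thesis by (rule Lcut)
qed

text \<open>Weakening covers contexts over the stratum. Otherwise \<open>Y = {p}\<close>, whose only
  proper subset is \<open>{}\<close>, and a cut with no premises leads from \<open>{}\<close> to
  \<open>Y\<close>.\<close>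

lemma atomic_mono:
  assumes "Atom ` Y \<in> Antecedents P p" "X \<subseteq> Y" and X: "(Atom ` X, \<theta>) \<in> R"
  shows "(Atom ` Y, \<theta>) \<in> R"
proof (cases "Y \<in> Fpow (Str P p)")
  case True
  with \<open>X \<subseteq> Y\<close> have "X \<in> Fpow (Str P p)" by (auto simp: Fpow_def finite_subset)
  with True W_set[of "Atom ` X" "Atom ` Y" \<theta>] X have "(Atom ` (X \<union> Y), \<theta>) \<in> R"
    by (simp add: Fpow_Lang image_Un) (simp add: Fpow_def)
  with \<open>X \<subseteq> Y\<close> show ?thesis by (simp add: Un_absorb1)
next
  case False
  then have "Y = {p}" using assms(1) by (simp add: Antecedents_eq Atom_image_antecedents)
  with \<open>X \<subseteq> Y\<close> consider "X = {}" | "X = Y" by blast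
  then show ?thesis
    using X atomic_cut[OF assms(1), of "{}"] by cases auto
qed

end

lemma (in cont_strat_conj_logic) conj_rel_over_Prv: "p \<in> Prp P \<Longrightarrow> conj_rel_over P p (Prv P p)"
  by (intro conj_rel_over.intro conj_rel_over_axioms.intro conj_rel_Prv
      cont_strat_conj_logic_axioms) (auto intro: Cut)

lemma (in global_consequence) conj_rel_over:
  assumes "cont_strat_conj_logic P" "p \<in> Prp P"
  shows "conj_rel_over P p (S p)"
proof (intro conj_rel_over.intro conj_rel_over_axioms.intro assms conj_rel.intro)
  show "\<Gamma> \<in> antecedents (Str P p) p" if "(\<Gamma>, \<phi>) \<in> S p" for \<Gamma> \<phi>
    using family assms(2) that by (auto simp: PiE_iff Antecedents_eq)
qed (use assms(2) in \<open>auto simp: W L_And R_And Antecedents_eq[symmetric] intro: Lcut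
      simp del: Un_insert_right\<close>)

context cont_strat_conj_logic
begin

text \<open>\<open>{i}\<close> is consistent at \<open>j\<close> either as the exceptional set
  \<open>{j}\<close> or as a subset of the stratum. The cases stay separate since \<open>j\<close>
  need not prove itself.\<close>

lemma R_cases:
  assumes "j \<in> Prp P" "frame_R (logic_frame P) i j"
  shows "i = j \<or> proves P j {Atom j} (Atom i)"
  using assms Str_Prv[of j i] by (auto simp: Con_logic_frame Fpow_def)

lemma truth_frame_logic_frame: "truth_frame (logic_frame P)"
proof ((intro truth_frame.intro strong_cont_info_frame.intro truth_frame_axioms.intro;
    (unfold_locales)?), goal_cases)
  case 1
  then show ?case using Str_Prp by (auto simp: logic_frame_def Con_logic_frame Fpow_def)
next
  case 2
  have "X \<in> Con (logic_frame P) p \<and> a \<in> Prp P" if "p \<in> Prp P" "proves P p (Atom ` X) (Atom a)"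
    for p X a
    using proves_Antecedents[OF that] proves_Str[OF that] Str_Prp[OF that(1)] that(1)
    by (auto simp: Con_logic_frame_iff)
  then show ?case by (auto simp: atomic_rel_def)
next
  case (3 i)
  then show ?case by (simp add: Con_logic_frame)
next
  case (4 i Y X)
  then show ?case by (auto simp: Con_logic_frame Fpow_def finite_subset)
next
  case (5 i Y X)
  then show ?case using proves_Str by (auto simp: Con_logic_frame Fpow_def atomic_rel_iff)
next
  case (6 i X Y a)
  then show ?case
    using conj_rel_over.atomic_mono[OF conj_rel_over_Prv, of i Y X]
    by (simp add: Con_logic_frame_iff atomic_rel_iff)
next
  case (7 i Y X a)
  then show ?case
    using conj_rel_over.atomic_cut[OF conj_rel_over_Prv, of i X Y]
    by (simp add: Con_logic_frame_iff atomic_rel_iff)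
next
  case (8 i j)
  then have "i = j \<or> proves P j {Atom j} (Atom i)" using R_cases by simp
  \<comment> \<open>Besides the inclusion of strata, the exceptional set \<open>{i}\<close> must be
    consistent at \<open>j\<close>, which is \<open>i \<in> Str P j\<close>.\<close>
  with 8 Str_mono[of i j] proves_Str[of j "{Atom j}" i] show ?case
    by (auto simp: Con_logic_frame Fpow_def)
next
  case (9 i j X a)
  then have "i = j \<or> proves P j {Atom j} (Atom i)" using R_cases by simp
  with 9 Prv_mono[of i j "Atom ` X" "Atom a"] show ?case
    by (auto simp: atomic_rel_iff)
next
  case (10 i Y X)
  then have i: "i \<in> Prp P" by simp
  have "Atom ` X \<in> Antecedents P i" "finite Y" "\<And>b. b \<in> Y \<Longrightarrow> proves P i (Atom ` X) (Atom b)"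
    using 10 by (simp_all add: Con_logic_frame_iff atomic_rel_iff Fpow_def)
  \<comment> \<open>(INT) concerns one formula, so \<open>Y\<close> is collected into a conjunction,
    with \<top> covering the empty case. The interpolating set will be
    \<open>atoms \<xi>\<close>.\<close>
  then obtain \<phi> where \<phi>: "atoms \<phi> = insert (Top P) Y" "proves P i (Atom ` X) \<phi>"
    using conjunction_of[OF i] by metis
  obtain r \<xi> where r: "r \<in> Str P i" "\<xi> \<in> LangAt P r"
      "proves P i (Atom ` X) (And (Atom r) \<xi>)" "proves P r {\<xi>} \<phi>"
    using INT[OF i \<phi>(2)] by blast
  have r_Prp: "r \<in> Prp P" using r(1) Str_Prp[OF i] by blast
  have "entails_set (logic_frame P) i X ({r} \<union> atoms \<xi>)"
    using i proves_iff[OF i, THEN iffD1, OF r(3)] by (auto simp: atomic_rel_iff)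
  moreover have "entails_set (logic_frame P) r (atoms \<xi>) Y"
    using proves_iff[OF r_Prp, THEN iffD1, OF r(4)] r_Prp by (auto simp: atomic_rel_iff \<phi>(1))
  moreover have "atoms \<xi> \<in> Con (logic_frame P) r"
    using r(2) r_Prp by (simp add: Lang_def Con_logic_frame Fpow_def finite_atoms)
  ultimately show ?case using r_Prp by auto
next
  case (11 i X)
  then show ?case using Str_Prv by (auto simp: Con_logic_frame Fpow_def atomic_rel_iff)
next
  case 12
  then show ?case
    using Top_in R_Top[of _ "{}"]
    by (auto simp: truth_element_def atomic_rel_iff Antecedents_def Con_logic_frame Fpow_def)
qed

end

text \<open>Right cuts come from (Rcut), monotonicity and left cuts from (W) and (Lcut). As these
  rules act on single formulas, finite sets of atoms are packed into formulas that may contain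
  \<top> in addition.\<close>

lemma truth_morphism_atomic_rel:
  assumes "cont_strat_conj_logic P" "cont_strat_conj_logic P'" "global_consequence P P' S"
  shows "truth_morphism (logic_frame P) (logic_frame P') (atomic_rel (Prp P) S)"
proof -
  interpret P: cont_strat_conj_logic P by fact
  interpret P': cont_strat_conj_logic P' by fact
  interpret S: global_consequence P P' S by fact
  interpret F: truth_frame "logic_frame P" by (rule P.truth_frame_logic_frame)
  interpret F': truth_frame "logic_frame P'" by (rule P'.truth_frame_logic_frame)
  have S_iff: "(\<Gamma>, \<phi>) \<in> S p \<longleftrightarrow>
      \<Gamma> \<in> Antecedents P p \<and> (\<forall>a \<in> atoms \<phi>. (Atom ` props \<Gamma>, Atom a) \<in> S p)"
    if "p \<in> Prp P" for p \<Gamma> \<phi>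
    unfolding Antecedents_eq
    by (rule conj_rel.rel_iff_atomic)
      (rule conj_rel_over.axioms(2)[OF S.conj_rel_over[OF P.cont_strat_conj_logic_axioms that]])
  have conj': "\<exists>\<phi>. atoms \<phi> = insert (Top P') Y \<and> (Atom ` X, \<phi>) \<in> S p"
    if "p \<in> Prp P" "Atom ` X \<in> Antecedents P p" "finite Y"
      "\<forall>b \<in> Y. (Atom ` X, Atom b) \<in> S p" for p X Y
  proof -
    have "\<exists>\<phi>. atoms \<phi> = insert (Top P') Y"
      using ex_form_atoms[of "insert (Top P') Y"] that(3) by simp
    then obtain \<phi> where "atoms \<phi> = insert (Top P') Y" ..
    with that S_iff[OF that(1), of "Atom ` X" \<phi>] S.R_Top[OF that(1,2)] show ?thesis by auto
  qed
  show ?thesis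
  proof ((intro truth_morphism.intro truth_morphism_axioms.intro frame_morphism.intro
      F.truth_frame_axioms F'.truth_frame_axioms F.cont_info_frame_axioms F'.cont_info_frame_axioms;
      (unfold_locales)?), goal_cases)
    case 1
    have "X \<in> Con (logic_frame P) p \<and> a \<in> Prp P'" if "p \<in> Prp P" "(Atom ` X, Atom a) \<in> S p"
      for p X a
    proof -
      have "S p \<subseteq> Antecedents P p \<times> Lang (Prp P')" using S.family that(1) by (auto simp: PiE_iff)
      then have "(Atom ` X, Atom a) \<in> Antecedents P p \<times> Lang (Prp P')" using that(2) by (rule subsetD)
      then show ?thesis using that(1) by (simp add: Con_logic_frame_iff Lang_def)
    qed
    then show ?case by (auto simp: atomic_rel_def)
  next
    case (2 i X k b Y)
    then have i: "i \<in> Prp P" and k: "k \<in> Prp P'" and b: "proves P' k (Atom ` Y) (Atom b)"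
      and X: "Atom ` X \<in> Antecedents P i"
      by (simp_all add: Con_logic_frame_iff atomic_rel_iff)
    \<comment> \<open>(Rcut) needs a formula \<open>\<psi>\<close> in place of \<open>Y\<close>. A
      possible extra \<top> is harmless: \<open>X\<close> is related to it by (R\<top>), and
      enlarging \<open>Y\<close> keeps \<open>b\<close> provable.\<close>
    have "Y \<in> Fpow (Str P' k) \<union> {{k}}"
      using P'.proves_Antecedents[OF k b] by (simp add: Antecedents_eq Atom_image_antecedents)
    then obtain \<psi> where \<psi>: "{\<psi>} \<in> antecedents (Str P' k) k" "Y \<subseteq> atoms \<psi>"
        "atoms \<psi> \<subseteq> insert (Top P') Y"
      using antecedent_formula P'.Top_Str[OF k] by metis
    from \<psi>(1) have "Atom ` atoms \<psi> \<in> Antecedents P' k"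
      using props_antecedents[OF \<psi>(1)] by (simp add: Antecedents_eq Atom_image_antecedents)
    then have "proves P' k (Atom ` atoms \<psi>) (Atom b)"
      using conj_rel_over.atomic_mono[OF P'.conj_rel_over_Prv[OF k] _ \<psi>(2) b] by blast
    then have "proves P' k {\<psi>} (Atom b)"
      using P'.proves_iff[OF k, of "{\<psi>}" "Atom b"] \<psi>(1) by (simp add: Antecedents_eq)
    moreover have "(Atom ` X, And (Atom k) \<psi>) \<in> S i"
      using S_iff[OF i, of "Atom ` X" "And (Atom k) \<psi>"] X S.R_Top[OF i X] 2 i \<psi>(3)
      by (auto simp: atomic_rel_iff)
    ultimately show ?case using S.Rcut[OF i k] i by (simp add: atomic_rel_iff)
  next
    case (3 i X X' b)
    then show ?case
      using conj_rel_over.atomic_mono[OF S.conj_rel_over, of i X' X] P.cont_strat_conj_logic_axioms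
      by (simp add: Con_logic_frame_iff atomic_rel_iff)
  next
    case (4 i X X' b)
    then show ?case
      using conj_rel_over.atomic_cut[OF S.conj_rel_over, of i X X'] P.cont_strat_conj_logic_axioms
      by (simp add: Con_logic_frame_iff atomic_rel_iff)
  next
    case (5 i j X b)
    then have "i = j \<or> proves P j {Atom j} (Atom i)" using P.R_cases by simp
    with 5 S.mono[of j i "Atom ` X" "Atom b"] show ?case
      by (auto simp: atomic_rel_iff)
  next
    case (6 i X F)
    then have i: "i \<in> Prp P" by simp
    obtain \<phi> where \<phi>: "atoms \<phi> = insert (Top P') F" "(Atom ` X, \<phi>) \<in> S i"
      using conj'[OF i, of X F] 6 by (auto simp: Con_logic_frame_iff atomic_rel_iff Fpow_def)
    obtain r \<theta> q \<psi> where *: "r \<in> Prp P" "\<theta> \<in> LangAt P r \<union> {Atom r}" "q \<in> Prp P'"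
        "\<psi> \<in> LangAt P' q \<union> {Atom q}" "proves P i (Atom ` X) (And (Atom r) \<theta>)"
        "({\<theta>}, And (Atom q) \<psi>) \<in> S r" "proves P' q {\<psi>} \<phi>"
      using S.interpolation[OF i \<phi>(2)] by blast
    have "entails_set (logic_frame P) i X ({r} \<union> atoms \<theta>)"
      using i P.proves_iff[OF i, THEN iffD1, OF *(5)] by (auto simp: atomic_rel_iff)
    moreover have "rel_set (atomic_rel (Prp P) S) r (atoms \<theta>) ({q} \<union> atoms \<psi>)"
      using *(1) S_iff[OF *(1), THEN iffD1, OF *(6)] by (auto simp: atomic_rel_iff)
    moreover have "entails_set (logic_frame P') q (atoms \<psi>) F"
      using P'.proves_iff[OF *(3), THEN iffD1, OF *(7)] *(3) by (auto simp: atomic_rel_iff \<phi>(1))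
    moreover have "atoms \<theta> \<in> Con (logic_frame P) r" "atoms \<psi> \<in> Con (logic_frame P') q"
      using *(1-4) by (auto simp: Lang_def Con_logic_frame Fpow_def finite_atoms)
    ultimately show ?case using *(1,3) unfolding logic_frame_simps(1) by blast
  next
    case 7
    then show ?case
      using S.R_Top[OF P.Top_in, of "{}"] P.Top_in
      by (simp add: atomic_rel_iff Antecedents_def Con_logic_frame Fpow_def)
  qed
qed

section \<open>The logic of a frame\<close>

definition cone :: "'a truth_frame \<Rightarrow> 'a \<Rightarrow> 'a set" where
  "cone A i = {a. entails A i {i} a}"

definition frame_logic :: "'a truth_frame \<Rightarrow> 'a csl" where
  "frame_logic A = \<lparr>Prp = Tok A, Top = Truth A, Str = (\<lambda>i \<in> Tok A. cone A i),
     Prv = formula_rel (Tok A) (cone A) (Ent A)\<rparr>"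

lemma frame_logic_simps [simp]:
  "Prp (frame_logic A) = Tok A" "Top (frame_logic A) = Truth A"
  "Prv (frame_logic A) = formula_rel (Tok A) (cone A) (Ent A)"
  "i \<in> Tok A \<Longrightarrow> Str (frame_logic A) i = cone A i"
  by (simp_all add: frame_logic_def)

lemma Antecedents_frame_logic [simp]:
  "i \<in> Tok A \<Longrightarrow> Antecedents (frame_logic A) i = antecedents (cone A i) i"
  by (simp add: Antecedents_eq)

context truth_frame
begin

text \<open>By strength \<open>{i}\<close> entails every other consistent set at \<open>i\<close>,
  so a cut gives it all their consequences.\<close>

lemma Ent_cone: "\<lbrakk>i \<in> Tok A; entails A i X a\<rbrakk> \<Longrightarrow> a \<in> cone A i"
  unfolding cone_def
  using strong[of i X] Ent_cut[of i "{i}" X a] Ent_Con[of i X a] Con_self[of i] by auto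

lemma cone_Tok: "i \<in> Tok A \<Longrightarrow> cone A i \<subseteq> Tok A"
  by (auto simp: cone_def dest: Ent_Tok)

text \<open>Strength gives one inclusion; the other holds because finite sets of entailed tokens are
  consistent.\<close>

lemma Con_cone:
  assumes i: "i \<in> Tok A"
  shows "Con A i = Fpow (cone A i) \<union> {{i}}"
proof (intro equalityI subsetI)
  fix X assume X: "X \<in> Con A i"
  show "X \<in> Fpow (cone A i) \<union> {{i}}"
  proof (cases "X = {i}")
    case False
    then show ?thesis using strong[OF i X] Con_finite[OF i X] by (auto simp: Fpow_def cone_def)
  qed simp
next
  fix X assume "X \<in> Fpow (cone A i) \<union> {{i}}"
  then show "X \<in> Con A i"
    using entails_set_Con[OF i Con_self[OF i], of X] Con_self[OF i] by (auto simp: Fpow_def cone_def)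
qed

lemma Con_props: "\<lbrakk>i \<in> Tok A; \<Gamma> \<in> antecedents (cone A i) i\<rbrakk> \<Longrightarrow> props \<Gamma> \<in> Con A i"
  unfolding Con_cone by (rule props_antecedents)

lemma Truth_cone: "i \<in> Tok A \<Longrightarrow> Truth A \<in> cone A i"
  by (rule Ent_cone[OF _ Truth_Ent])

lemma cone_mono:
  assumes "i \<in> Tok A" "j \<in> cone A i"
  shows "cone A j \<subseteq> cone A i"
  using assms Ent_along[of i "{i}" j "{j}"] Ent_cone unfolding cone_def by blast

text \<open>The exceptional antecedent \<open>{Atom j}\<close> becomes a set of formulas over the
  cone of \<open>i\<close>.\<close>

lemma antecedents_mono:
  assumes "i \<in> Tok A" "j \<in> cone A i"
  shows "antecedents (cone A j) j \<subseteq> antecedents (cone A i) i"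
  using cone_mono[OF assms] assms(2) unfolding antecedents_def Fpow_Lang[abs_def] subset_iff Un_iff
  by (auto simp: Fpow_Lang)

text \<open>Since \<open>X\<close> may be empty, the truth element can be needed to form
  \<open>\<psi>\<close>. It lies in every cone and is entailed by every consistent set.\<close>

lemma Con_formula:
  assumes "i \<in> Tok A" "X \<in> Con A i"
  obtains \<psi> where "{\<psi>} \<in> antecedents (cone A i) i" "X \<subseteq> atoms \<psi>"
    "atoms \<psi> \<subseteq> insert (Truth A) X" "atoms \<psi> \<in> Con A i"
proof -
  obtain \<psi> where \<psi>: "{\<psi>} \<in> antecedents (cone A i) i" "X \<subseteq> atoms \<psi>"
      "atoms \<psi> \<subseteq> insert (Truth A) X"
    using antecedent_formula[of X "cone A i" i "Truth A"] assms Con_cone Truth_cone by metis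
  with that Con_props[OF assms(1), of "{\<psi>}"] show thesis by simp
qed

end

section \<open>The global consequence relation of an approximable family\<close>

context truth_morphism
begin

abbreviation "S \<equiv> formula_rel (Tok A) (cone A) H"

lemma global_consequence_formula_rel: "global_consequence (frame_logic A) (frame_logic A') S"
proof (standard, goal_cases)
  case 1
  then show ?case
    by (auto simp: formula_rel_def Lang_def dest: rel_Tok)
next
  case (2 i \<Gamma>)
  then show ?case by (simp add: formula_rel_iff dom.Con_props rel_Truth)
next
  case (3 i \<Delta> \<xi> \<phi>)
  then have i: "i \<in> Tok A" and ant: "\<Delta> \<union> {\<xi>} \<in> antecedents (cone A i) i"
    unfolding antecedents_def by (simp_all add: Fpow_Lang) (simp add: Lang_def)
  with 3 show ?case
    using weaken[OF i, of "props \<Delta>" _ "props (\<Delta> \<union> {\<xi>})"] dom.Con_props[OF i ant]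
    by (auto simp: formula_rel_iff)
next
  case (4 i \<Delta> \<phi> \<psi> \<theta>)
  then have "\<Delta> \<union> {\<phi>, \<psi>} \<in> antecedents (cone A i) i" "\<Delta> \<union> {And \<phi> \<psi>} \<in> antecedents (cone A i) i"
    unfolding antecedents_def by (simp_all add: Fpow_Lang) (simp_all add: Lang_def)
  then show ?case using 4 by (simp add: formula_rel_iff Un_assoc)
next
  case (5 i \<Gamma> \<phi> \<psi>)
  then show ?case by (auto simp: formula_rel_iff)
next
  case (6 i \<Gamma> \<phi> \<psi>)
  then show ?case
    using cut_left[of i "props \<Gamma>" "atoms \<phi>"] dom.Con_props[of i \<Gamma>] by (simp add: formula_rel_iff)
next
  case (7 i q \<Gamma> \<psi> \<theta>)
  then have i: "i \<in> Tok A" and "\<Gamma> \<in> antecedents (cone A i) i"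
    and "rel_set H i (props \<Gamma>) (insert q (atoms \<psi>))" "entails_set A' q (atoms \<psi>) (atoms \<theta>)"
    by (simp_all add: formula_rel_iff)
  then show ?case
    unfolding formula_rel_iff[OF i] by (blast intro: cut_right[OF i])
next
  case (8 i j \<Gamma> \<psi>)
  then have *: "i \<in> Tok A" "entails A i {i} j" "j \<in> Tok A"
    by (simp_all add: formula_rel_iff)
  then have "antecedents (cone A j) j \<subseteq> antecedents (cone A i) i"
    by (intro dom.antecedents_mono) (auto simp: cone_def)
  with 8 * show ?case
    using along[OF *(1,2)] by (auto simp: formula_rel_iff)
next
  case (9 i \<Gamma> \<phi>)
  then have i: "i \<in> Tok A" and \<Gamma>: "\<Gamma> \<in> antecedents (cone A i) i"
    and "rel_set H i (props \<Gamma>) (atoms \<phi>)"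
    by (simp_all add: formula_rel_iff)
  then obtain c e U V where *: "c \<in> Tok A" "e \<in> Tok A'" "U \<in> Con A c" "V \<in> Con A' e"
      "entails_set A i (props \<Gamma>) (insert c U)" "rel_set H c U (insert e V)"
      "entails_set A' e V (atoms \<phi>)"
    using interpolate[of i "props \<Gamma>" "atoms \<phi>"] dom.Con_props finite_atoms by metis
  \<comment> \<open>\<open>U\<close> and \<open>V\<close> are traded for formulas. A possible extra
    truth element holds wherever it occurs as a conclusion, and monotonicity admits it in
    antecedents.\<close>
  obtain \<theta> where \<theta>: "{\<theta>} \<in> antecedents (cone A c) c" "U \<subseteq> atoms \<theta>"
      "atoms \<theta> \<subseteq> insert (Truth A) U" "atoms \<theta> \<in> Con A c"
    using dom.Con_formula *(1,3) by metis
  obtain \<psi> where \<psi>: "{\<psi>} \<in> antecedents (cone A' e) e" "V \<subseteq> atoms \<psi>"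
      "atoms \<psi> \<subseteq> insert (Truth A') V" "atoms \<psi> \<in> Con A' e"
    using cod.Con_formula *(2,4) by metis
  have "(\<Gamma>, And (Atom c) \<theta>) \<in> Prv (frame_logic A) i"
    using * i \<Gamma> \<theta>(3) dom.Ent_Truth dom.Con_props by (auto simp: formula_rel_iff)
  moreover have "({\<theta>}, And (Atom e) \<psi>) \<in> S c"
    using * \<theta> \<psi>(3) weaken[OF *(1) _ \<theta>(2,4)] rel_Truth by (auto simp: formula_rel_iff)
  moreover have "({\<psi>}, \<phi>) \<in> Prv (frame_logic A') e"
    using * \<psi> cod.Ent_mono[OF *(2,4) \<psi>(4,2)] by (auto simp: formula_rel_iff)
  ultimately show ?case
    using *(1,2) \<theta>(1) \<psi>(1) unfolding singleton_antecedents
    by (metis frame_logic_simps(1,4))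
qed

end

text \<open>The identity family yields a global consequence relation, which supplies the structural
  rules. Left over are the conditions on strata and (INT), where \<open>\<xi>\<close> must be a
  formula over the stratum of \<open>r\<close>, whereas global interpolation also allows
  \<open>Atom r\<close>.\<close>

lemma (in truth_frame) cont_strat_conj_logic_frame_logic: "cont_strat_conj_logic (frame_logic A)"
proof -
  interpret Ent: truth_morphism A A "Ent A" by (rule truth_morphism_Ent)
  interpret gc: global_consequence "frame_logic A" "frame_logic A" "Prv (frame_logic A)"
    using Ent.global_consequence_formula_rel by simp
  show ?thesis
  proof (standard, goal_cases)
    case 1
    then show ?case by (simp add: Truth_Tok)
  next
    case 2
    then show ?case using cone_Tok by (auto simp: frame_logic_def)
  next
    case 3
    then show ?case by (auto simp: formula_rel_def Lang_def Ent_cone)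
  next
    case (4 p q)
    then show ?case
      by (simp add: formula_rel_iff singleton_antecedents) (simp add: cone_def)
  next
    case (5 p q)
    then show ?case using cone_mono[of q p] by (simp add: formula_rel_iff) (simp add: cone_def)
  next
    case (6 p q \<Gamma> \<theta>)
    then show ?case by (intro gc.mono[OF 6(2,1,3,4)])
  next
    case (7 p \<Gamma>)
    then show ?case using gc.R_Top[of p \<Gamma>] by simp
  next
    case (8 p \<Delta> \<phi> \<psi> \<theta>)
    then show ?case by (rule gc.L_And)
  next
    case (9 p \<Gamma> \<phi> \<psi>)
    then show ?case by (rule gc.R_And)
  next
    case (10 p \<Gamma> \<phi> \<psi>)
    then show ?case by (rule gc.Lcut)
  next
    case (11 p \<Delta> \<xi> \<phi>)
    then show ?case by (rule gc.W)
  next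
    case (12 p \<Gamma> \<phi>)
    then have p: "p \<in> Tok A" and \<Gamma>: "\<Gamma> \<in> antecedents (cone A p) p"
      and \<phi>: "entails_set A p (props \<Gamma>) (atoms \<phi>)"
      by (simp_all add: formula_rel_iff)
    note X = Con_props[OF p \<Gamma>]
    text \<open>Interpolating twice yields an antecedent \<open>insert e Z\<close> inside the cone of \<open>r\<close>, as is
      required of the formula \<open>\<xi>\<close>; the first interpolant \<open>Y\<close> may be \<open>{r}\<close>, with \<open>r\<close> outside
      of its own cone.\<close>
    obtain r Y where r: "r \<in> Tok A" "Y \<in> Con A r" "entails_set A p (props \<Gamma>) (insert r Y)"
        "entails_set A r Y (atoms \<phi>)"
      using interpolate[OF p X finite_atoms \<phi>] by metis
    obtain e Z where e: "e \<in> Tok A" "Z \<in> Con A e" "entails_set A r Y (insert e Z)"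
        "entails_set A e Z (atoms \<phi>)"
      using interpolate[OF r(1,2) finite_atoms r(4)] by metis
    obtain \<xi> where \<xi>: "atoms \<xi> = insert e Z"
      using ex_form_atoms[of "insert e Z"] Con_finite[OF e(1,2)] by auto
    have "\<xi> \<in> Lang (cone A r)"
      using e(3) Ent_cone[OF r(1)] by (auto simp: Lang_def \<xi>)
    moreover have "\<Gamma> \<in> antecedents (cone A p) p \<and>
        entails_set A p (props \<Gamma>) (insert r (atoms \<xi>))"
    proof -
      \<comment> \<open>\<open>Y\<close> entails \<open>b\<close> at \<open>r\<close>; this moves to
        \<open>p\<close>, where \<open>r\<close> is entailed, and \<open>Y\<close> is cut against
        \<open>props \<Gamma>\<close>.\<close>
      have "entails A p (props \<Gamma>) b" if "b \<in> insert e Z" for b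
        using r(3) e(3) that Ent_along[OF p, of "props \<Gamma>" r Y b] Ent_cut[OF p X, of Y b] by blast
      then show ?thesis using \<Gamma> r(3) by (simp add: \<xi>)
    qed
    moreover have "entails_set A r (atoms \<xi>) (atoms \<phi>)"
    proof
      fix b assume "b \<in> atoms \<phi>"
      then have "entails A r Z b" using e(3,4) Ent_along[OF r(1), of Y e Z b] by blast
      moreover have "insert e Z \<in> Con A r"
        using entails_set_Con[OF r(1,2) _ e(3)] Con_finite[OF e(1,2)] by simp
      ultimately show "entails A r (atoms \<xi>) b"
        using Ent_mono[OF r(1), of Z "insert e Z" b] Ent_Con[OF r(1)] by (auto simp: \<xi>)
    qed
    moreover have "r \<in> cone A p" using r(3) Ent_cone[OF p] by blast
    ultimately show ?case
      using p r(1)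
      by (intro bexI[of _ r] bexI[of _ \<xi>]) (simp_all add: formula_rel_iff singleton_antecedents)
  qed
qed

section \<open>The isomorphism\<close>

text \<open>From left to right, \<open>comp_common\<close> sends all atoms of \<open>\<phi>\<close>
  through one pair \<open>(e, V)\<close>, and \<open>Con_formula\<close> turns \<open>V\<close> into
  a formula. Conversely, the atoms of the intermediate formula serve as the intermediate
  set.\<close>

lemma formula_rel_comp_families:
  assumes "truth_morphism A A' G" "truth_morphism A' A'' H"
  shows "formula_rel (Tok A) (cone A) (comp_families A A' A'' G H) =
    comp_consequence (frame_logic A) (frame_logic A') (frame_logic A'')
      (formula_rel (Tok A) (cone A) G) (formula_rel (Tok A') (cone A') H)"
    (is "?L = ?R")
proof (rule extensionalityI[of _ "Tok A"])
  interpret G: truth_morphism A A' G by fact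
  interpret H: truth_morphism A' A'' H by fact
  interpret composable A A' A'' G H ..
  show "?L \<in> extensional (Tok A)" "?R \<in> extensional (Tok A)"
    by (simp_all add: formula_rel_def comp_consequence_def)
  fix i assume i: "i \<in> Tok A"
  have "(\<Gamma>, \<phi>) \<in> ?L i \<longleftrightarrow> (\<Gamma>, \<phi>) \<in> ?R i" for \<Gamma> \<phi>
  proof
    assume "(\<Gamma>, \<phi>) \<in> ?L i"
    then have \<Gamma>: "\<Gamma> \<in> antecedents (cone A i) i" and \<phi>: "rel_set GH i (props \<Gamma>) (atoms \<phi>)"
      by (simp_all add: formula_rel_iff i)
    note X = G.dom.Con_props[OF i \<Gamma>]
    obtain e V where e: "e \<in> Tok A'" "V \<in> Con A' e" "rel_set G i (props \<Gamma>) (insert e V)"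
        "rel_set H e V (atoms \<phi>)"
      using comp_common[OF i X finite_atoms \<phi>] by metis
    obtain \<psi> where \<psi>: "{\<psi>} \<in> antecedents (cone A' e) e" "V \<subseteq> atoms \<psi>"
        "atoms \<psi> \<subseteq> insert (Truth A') V" "atoms \<psi> \<in> Con A' e"
      using G.cod.Con_formula e(1,2) by metis
    have "(\<Gamma>, And (Atom e) \<psi>) \<in> formula_rel (Tok A) (cone A) G i"
      using e(3) \<psi>(3) \<Gamma> G.rel_Truth[OF i X] by (auto simp: formula_rel_iff i)
    moreover have "({\<psi>}, \<phi>) \<in> formula_rel (Tok A') (cone A') H e"
      using e(1,4) \<psi>(1) H.weaken[OF e(1) _ \<psi>(2,4)] by (auto simp: formula_rel_iff)
    moreover have "\<phi> \<in> Lang (Tok A'')"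
      using e(1,4) H.rel_Tok by (auto simp: Lang_def)
    ultimately show "(\<Gamma>, \<phi>) \<in> ?R i"
      using i e(1) \<Gamma> \<psi>(1) unfolding singleton_antecedents
      by (auto simp: comp_consequence_def)
  next
    assume "(\<Gamma>, \<phi>) \<in> ?R i"
    then obtain q \<psi> where "q \<in> Tok A'" "(\<Gamma>, And (Atom q) \<psi>) \<in> formula_rel (Tok A) (cone A) G i"
        "({\<psi>}, \<phi>) \<in> formula_rel (Tok A') (cone A') H q"
      using i by (auto simp: comp_consequence_def)
    then show "(\<Gamma>, \<phi>) \<in> ?L i"
      using i comp_intro[OF i, of q "atoms \<psi>" "props \<Gamma>"] by (simp add: formula_rel_iff)
  qed
  then show "?L i = ?R i" by auto
qed

text \<open>Members of the stratum are provable from \<open>p\<close> by \<open>Str_Prv\<close>, and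
  conclusions at \<open>p\<close> stay in the language of its stratum.\<close>

lemma cone_logic_frame:
  assumes "cont_strat_conj_logic P" "p \<in> Prp P"
  shows "cone (logic_frame P) p = Str P p"
  using assms cont_strat_conj_logic.Str_Prv[of P p] cont_strat_conj_logic.proves_Str[of P p]
  by (auto simp: cone_def atomic_rel_iff)

lemma (in global_consequence) formula_rel_atomic_rel:
  assumes "cont_strat_conj_logic P"
  shows "formula_rel (Prp P) (cone (logic_frame P)) (atomic_rel (Prp P) S) = S"
proof (rule extensionalityI[of _ "Prp P"])
  show "S \<in> extensional (Prp P)" using family by (simp add: PiE_def)
  show "formula_rel (Prp P) (cone (logic_frame P)) (atomic_rel (Prp P) S) \<in> extensional (Prp P)"
    by (simp add: formula_rel_def)
  fix p assume p: "p \<in> Prp P"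
  interpret conj_rel_over P p "S p" by (rule conj_rel_over[OF assms p])
  have "(\<Gamma>, \<phi>) \<in> formula_rel (Prp P) (cone (logic_frame P)) (atomic_rel (Prp P) S) p \<longleftrightarrow>
      (\<Gamma>, \<phi>) \<in> S p" for \<Gamma> \<phi>
    by (subst rel_iff_atomic)
      (simp add: formula_rel_iff[OF p] atomic_rel_iff[OF p] cone_logic_frame[OF assms p])
  then show "formula_rel (Prp P) (cone (logic_frame P)) (atomic_rel (Prp P) S) p = S p" by auto
qed

lemma frame_logic_logic_frame:
  assumes "cont_strat_conj_logic P"
  shows "frame_logic (logic_frame P) = P"
proof -
  interpret cont_strat_conj_logic P by fact
  have "(\<lambda>p \<in> Prp P. cone (logic_frame P) p) = Str P"
    using Str_family
    by (intro extensionalityI[of _ "Prp P"]) (auto simp: cone_logic_frame[OF assms] PiE_def)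
  moreover have "formula_rel (Prp P) (cone (logic_frame P)) (atomic_rel (Prp P) (Prv P)) = Prv P"
  proof (rule extensionalityI[of _ "Prp P"])
    show "Prv P \<in> extensional (Prp P)" using Prv_family by (simp add: PiE_def)
    fix p assume p: "p \<in> Prp P"
    have "(\<Gamma>, \<phi>) \<in> formula_rel (Prp P) (cone (logic_frame P)) (atomic_rel (Prp P) (Prv P)) p \<longleftrightarrow>
        proves P p \<Gamma> \<phi>" for \<Gamma> \<phi>
      by (subst proves_iff[OF p])
        (simp add: formula_rel_iff[OF p] atomic_rel_iff[OF p] cone_logic_frame[OF assms p]
          Antecedents_eq)
    then show "formula_rel (Prp P) (cone (logic_frame P)) (atomic_rel (Prp P) (Prv P)) p = Prv P p"
      by auto
  qed (simp add: formula_rel_def)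
  ultimately show ?thesis by (simp add: frame_logic_def)
qed

lemma (in truth_morphism) atomic_rel_formula_rel:
  "atomic_rel (Tok A) (formula_rel (Tok A) (cone A) H) = H"
proof (rule atomic_rel_formula_rel)
  show "H \<in> extensional (Tok A)" using family by (simp add: PiE_def)
  show "X \<in> Fpow (cone A i) \<union> {{i}}" if "i \<in> Tok A" "(X, a) \<in> H i" for i X a
    using rel_Con[OF that] by (simp only: dom.Con_cone[OF that(1)])
qed

text \<open>Strength enters through \<open>Con_cone\<close>, by which \<open>Con A\<close> is
  rebuilt from the cones.\<close>

lemma (in truth_frame) logic_frame_frame_logic: "logic_frame (frame_logic A) = A"
proof -
  interpret Ent: truth_morphism A A "Ent A" by (rule truth_morphism_Ent)
  have "(\<lambda>i \<in> Tok A. Fpow (Str (frame_logic A) i) \<union> {{i}}) = Con A"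
    using Con_family by (intro extensionalityI[of _ "Tok A"]) (auto simp: Con_cone PiE_def)
  moreover have "atomic_rel (Tok A) (Prv (frame_logic A)) = Ent A"
    using Ent.atomic_rel_formula_rel by simp
  ultimately show ?thesis by (simp add: logic_frame_def)
qed

theorem theorem8p11:
  shows "isomorphic_categories
    (CSL :: ('a csl, 'a csl_rel) cat)
    (SIFt :: ('a truth_frame, ('a, 'a) rel_family) cat)"
proof (rule isomorphic_categoriesI[where Fo = logic_frame and Go = frame_logic
      and Fm = "\<lambda>P P'. atomic_rel (Prp P)" and Gm = "\<lambda>A A'. formula_rel (Tok A) (cone A)"],
    goal_cases)
  \<comment> \<open>The category laws are checked for frames and functoriality for the passage from
    frames to logics; the rest is transported.\<close>
  case 1
  then show ?case by (rule category_SIFt)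
next
  case (2 P)
  then show ?case
    by (simp add: CSL_def Obj_SIFt cont_strat_conj_logic.truth_frame_logic_frame)
next
  case (3 A)
  then show ?case
    by (simp add: CSL_def Obj_SIFt truth_frame.cont_strat_conj_logic_frame_logic)
next
  case (4 P)
  then show ?case by (simp add: CSL_def frame_logic_logic_frame)
next
  case (5 A)
  then show ?case by (simp add: Obj_SIFt truth_frame.logic_frame_frame_logic)
next
  case (6 P P' S)
  then show ?case
    by (simp add: CSL_def Hom_SIFt Obj_SIFt cont_strat_conj_logic.truth_frame_logic_frame
        truth_morphism_atomic_rel)
next
  case (7 A A' H)
  then show ?case
    by (simp add: Hom_SIFt truth_morphism.global_consequence_formula_rel)
      (simp add: CSL_def truth_morphism.global_consequence_formula_rel)
next
  case (8 P P' S)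
  then show ?case by (simp add: CSL_def global_consequence.formula_rel_atomic_rel)
next
  case (9 A A' H)
  then show ?case by (simp add: Hom_SIFt truth_morphism.atomic_rel_formula_rel)
next
  case (10 A)
  then show ?case by (simp add: CSL_def Id_SIFt)
next
  case (11 A A' A'' G H)
  then show ?case
    by (simp add: Hom_SIFt Comp_SIFt formula_rel_comp_families) (simp add: CSL_def)
qed

end
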